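(* Any metric ultrapower of the group $\mathcal{IET}$ of interval exchange transformations with respect to the norm $\|\cdot\|_\mu$ (and any non-principal ultrafilter on $\mathbb N$) is a simple group, in fact a boundedly simple group.
   Context: An interval exchange transformation is a bijective map $f\colon[0,1]\to[0,1]$ which is a piecewise translation, continuous on the right, with finitely many discontinuity points. $\mathcal{IET}$ is the group of all such maps under composition. Its bi-invariant norm is $\|g\|_\mu=\mu(\mathrm{supp}(g))$, where $\mathrm{supp}(g)=\{x : g(x)\ne x\}$ and $\mu$ is Lebesgue measure. For a group $G$ with bi-invariant norm $\|\cdot\|$ bounded above and a non-principal ultrafilter $\mathcal U$ on $\mathbb N$, the metric ultrapower is $G^{\mathbb N}/\mathcal E$, $\mathcal E=\{(g_n) : \lim_{n\to\mathcal U}\|g_n\|=0\}$. A group $G$ is boundedly simple if for every $g\in G\setminus\{e\}$ there is $N\in\mathbb N$ such that every element of $G$ is a product of at most $N$ conjugates of $g$ and $g^{-1}$. *)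

theory Defs
  imports "HOL-Analysis.Analysis" "HOL-Algebra.Product_Groups" "HOL-Algebra.Bij"
begin

definition discontinuities :: "(real \<Rightarrow> real) \<Rightarrow> real set" where
  "discontinuities f = {x \<in> {0..1}. \<not> continuous (at x within {0..1}) f}"

text \<open>
  Elements of \<^term>\<open>Bij {0..1}\<close> are \<^term>\<open>undefined\<close> outside \<open>[0,1]\<close>. Right continuity says
  nothing at the right end point 1, but bijectivity forces an interval exchange to fix it.
\<close>

definition interval_exchange :: "(real \<Rightarrow> real) \<Rightarrow> bool" where
  "interval_exchange f \<longleftrightarrow>
     f \<in> Bij {0..1} \<and>
     finite (discontinuities f) \<and>
     (\<forall>x\<in>{0..<1}. continuous (at_right x) f) \<and>
     (\<forall>a b. 0 \<le> a \<and> a < b \<and> b \<le> 1 \<and> {a<..<b} \<inter> discontinuities f = {} \<longrightarrow>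
        (\<exists>c. \<forall>x\<in>{a<..<b}. f x = x + c))"

definition IET :: "(real \<Rightarrow> real) monoid" where
  "IET = BijGroup {0..1} \<lparr>carrier := {f. interval_exchange f}\<rparr>"

definition iet_support :: "(real \<Rightarrow> real) \<Rightarrow> real set" where
  "iet_support g = {x \<in> {0..1}. g x \<noteq> x}"

definition iet_norm :: "(real \<Rightarrow> real) \<Rightarrow> real" where
  "iet_norm g = measure lebesgue (iet_support g)"

text \<open>An ultrafilter is given as a filter \<open>U\<close>; its members are the sets \<open>{n. P n}\<close> with
  \<^term>\<open>eventually P U\<close>.\<close>

definition nonprincipal_ultrafilter :: "'i filter \<Rightarrow> bool" where
  "nonprincipal_ultrafilter U \<longleftrightarrow>
     U \<noteq> bot \<and>
     (\<forall>P. eventually P U \<or> eventually (\<lambda>i. \<not> P i) U) \<and>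
     (\<forall>i. U \<noteq> principal {i})"

definition null_sequences ::
  "('a, 'b) monoid_scheme \<Rightarrow> ('a \<Rightarrow> real) \<Rightarrow> nat filter \<Rightarrow> (nat \<Rightarrow> 'a) set" where
  "null_sequences G nrm U =
     {g \<in> carrier (product_group UNIV (\<lambda>_. G)). ((\<lambda>n. nrm (g n)) \<longlongrightarrow> 0) U}"

definition metric_ultrapower ::
  "('a, 'b) monoid_scheme \<Rightarrow> ('a \<Rightarrow> real) \<Rightarrow> nat filter \<Rightarrow> (nat \<Rightarrow> 'a) set monoid" where
  "metric_ultrapower G nrm U = product_group UNIV (\<lambda>_. G) Mod null_sequences G nrm U"

text \<open>
  The library locale \<open>simple_group\<close> (theory \<open>SimpleGroups\<close>) requires \<open>order G > 1\<close>, where the order is a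
  \<^const>\<open>card\<close> and hence 0 for infinite groups; so no infinite group satisfies it.
\<close>

definition is_simple :: "('a, 'b) monoid_scheme \<Rightarrow> bool" where
  "is_simple G \<longleftrightarrow>
     group G \<and> carrier G \<noteq> {\<one>\<^bsub>G\<^esub>} \<and>
     (\<forall>H. H \<lhd> G \<longrightarrow> H = carrier G \<or> H = {\<one>\<^bsub>G\<^esub>})"

definition conjugates_pm :: "('a, 'b) monoid_scheme \<Rightarrow> 'a \<Rightarrow> 'a set" where
  "conjugates_pm G g =
     {h \<otimes>\<^bsub>G\<^esub> k \<otimes>\<^bsub>G\<^esub> inv\<^bsub>G\<^esub> h | h k. h \<in> carrier G \<and> k \<in> {g, inv\<^bsub>G\<^esub> g}}"

definition boundedly_simple :: "('a, 'b) monoid_scheme \<Rightarrow> bool" where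
  "boundedly_simple G \<longleftrightarrow>
     group G \<and>
     (\<forall>g \<in> carrier G - {\<one>\<^bsub>G\<^esub>}. \<exists>N. \<forall>x \<in> carrier G.
        \<exists>cs. length cs \<le> N \<and> set cs \<subseteq> conjugates_pm G g \<and>
             x = foldr (\<otimes>\<^bsub>G\<^esub>) cs \<one>\<^bsub>G\<^esub>)"

end

theory Submission
  imports Defs
begin

text \<open>
  Fix \<open>\<epsilon> > 0\<close> and let \<open>g\<close> be an interval exchange of norm at least \<open>\<epsilon>\<close>. There is a finite union of
  intervals \<open>B\<close> of measure at least \<open>\<epsilon>/3\<close> with \<open>g B\<close> disjoint from \<open>B\<close>, and for an involution \<open>s\<close>
  supported in \<open>B\<close> the commutator \<open>[g, s]\<close> is an involution whose support is twice as large. Since two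
  involutions in \<open>\<I>\<E>\<T>\<close> with supports of equal measure are conjugate, every involution is a product of
  a number of conjugates of such commutators which depends only on \<open>\<epsilon>\<close>. On the other hand, by a
  Rokhlin-type argument every \<open>h\<close> is arbitrarily close to an element of finite order, and those are
  products of two involutions. So up to an arbitrarily small error, \<open>h\<close> is a product of a number
  depending only on \<open>\<epsilon>\<close> of factors \<open>w [g, s] w\<inverse>\<close>, and in the metric ultrapower the error
  disappears.
\<close>

section \<open>Piecewise translations\<close>

text \<open>An error term is unavoidable. A product of commutators is killed by every homomorphism
  into an abelian group, and the Sah-Arnoux-Fathi invariant is such a homomorphism on interval
  exchanges which does not vanish on irrational rotations; so a general \<open>h\<close> is not
  exactly a product of commutators. A nontrivial class of the ultrapower has norm at least some
  fixed \<epsilon> > 0 on a set of coordinates belonging to the ultrafilter. At coordinate n the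
  error can be made at most 1/(n+1), but the factors found there have to fit together into finitely
  many sequences. This works only if their number is the same at all coordinates, whence the
  insistence on a bound in terms of \<epsilon> alone. All sets in play are finite unions of
  half-open intervals. Such a set is empty as soon as it is null, so identities that a measure
  argument would give almost everywhere hold everywhere, and no null sets have to be
  discarded.\<close>

inductive pw_trans :: "(real \<Rightarrow> real) \<Rightarrow> real set \<Rightarrow> bool" for f where
  empty: "pw_trans f {}"
| insert: "pw_trans f A \<Longrightarrow> (\<And>x. x \<in> {a..<b} \<Longrightarrow> f x = x + c) \<Longrightarrow> pw_trans f (A \<union> {a..<b})"

text \<open>For the identity the translation condition holds on every interval with
  \<open>c = 0\<close>, so what remains is being a finite union of half-open intervals. The
  intervals may overlap or be empty; no normal form is kept.\<close>

abbreviation elementary :: "real set \<Rightarrow> bool" where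
  "elementary A \<equiv> pw_trans (\<lambda>x. x) A"

lemma pw_trans_interval: "(\<And>x. x \<in> {a..<b} \<Longrightarrow> f x = x + c) \<Longrightarrow> pw_trans f {a..<b}"
  using pw_trans.insert[OF pw_trans.empty, of a b f c] by simp

lemma elementary_interval [simp]: "elementary {a..<b}"
  by (rule pw_trans_interval[where c = 0]) simp

lemma pw_trans_elementary: "pw_trans f A \<Longrightarrow> elementary A"
proof (induction rule: pw_trans.induct)
  case (insert A a b c)
  show ?case by (rule pw_trans.insert[where c = 0, OF insert.IH]) simp
qed (rule pw_trans.empty)

lemma pw_trans_cong: "pw_trans f A \<Longrightarrow> (\<And>x. x \<in> A \<Longrightarrow> f x = g x) \<Longrightarrow> pw_trans g A"
proof (induction rule: pw_trans.induct)
  case (insert A a b c)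
  show ?case
  proof (rule pw_trans.insert[where c = c])
    show "pw_trans g A" using insert by simp
    show "\<And>x. x \<in> {a..<b} \<Longrightarrow> g x = x + c" using insert by (metis UnCI)
  qed
qed (rule pw_trans.empty)

lemma pw_trans_Un:
  assumes "pw_trans f A" "pw_trans f B" shows "pw_trans f (A \<union> B)"
  using assms(2)
proof (induction rule: pw_trans.induct)
  case (insert B a b c)
  have "pw_trans f (A \<union> B \<union> {a..<b})" by (rule pw_trans.insert[where c = c]) (use insert in auto)
  then show ?case by (simp add: Un_assoc)
qed (simp add: assms(1))

lemma pw_trans_UN:
  "finite I \<Longrightarrow> (\<And>i. i \<in> I \<Longrightarrow> pw_trans f (A i)) \<Longrightarrow> pw_trans f (\<Union>i\<in>I. A i)"
  by (induction rule: finite_induct) (auto intro: pw_trans_Un pw_trans.empty)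

lemma pw_trans_Int_interval: "pw_trans f A \<Longrightarrow> pw_trans f (A \<inter> {u..<v})"
proof (induction rule: pw_trans.induct)
  case (insert A a b c)
  have *: "(A \<union> {a..<b}) \<inter> {u..<v} = (A \<inter> {u..<v}) \<union> {max a u..<min b v}" by auto
  show ?case unfolding * by (rule pw_trans.insert[where c = c]) (use insert in auto)
qed (simp add: pw_trans.empty)

lemma pw_trans_Int:
  assumes "pw_trans f A" "elementary B" shows "pw_trans f (A \<inter> B)"
  using assms(2)
proof (induction rule: pw_trans.induct)
  case (insert B a b c)
  then show ?case
    by (auto simp: Int_Un_distrib intro: pw_trans_Un pw_trans_Int_interval assms(1))
qed (simp add: pw_trans.empty)

lemma pw_trans_subset: "pw_trans f A \<Longrightarrow> elementary B \<Longrightarrow> B \<subseteq> A \<Longrightarrow> pw_trans f B"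
  by (metis inf.absorb2 pw_trans_Int)

lemma pw_trans_Diff_interval: "pw_trans f A \<Longrightarrow> pw_trans f (A - {u..<v})"
proof (induction rule: pw_trans.induct)
  case (insert A a b c)
  show ?case
  proof (cases "u < v")
    case True
    then have *: "(A \<union> {a..<b}) - {u..<v} = ((A - {u..<v}) \<union> {a..<min b u}) \<union> {max a v..<b}" by auto
    have "pw_trans f ((A - {u..<v}) \<union> {a..<min b u})"
      by (rule pw_trans.insert[where c = c]) (use insert in auto)
    then show ?thesis unfolding * by (rule pw_trans.insert[where c = c]) (use insert in auto)
  next
    case False
    then have "(A \<union> {a..<b}) - {u..<v} = A \<union> {a..<b}" by auto
    then show ?thesis using insert.hyps pw_trans.insert by metis
  qed
qed (simp add: pw_trans.empty)

lemma pw_trans_Diff: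
  assumes "pw_trans f A" "elementary B" shows "pw_trans f (A - B)"
  using assms(2)
proof (induction rule: pw_trans.induct)
  case (insert B a b c)
  have *: "A - (B \<union> {a..<b}) = (A - B) - {a..<b}" by auto
  show ?case unfolding * by (rule pw_trans_Diff_interval) (rule insert)
qed (simp add: assms(1))

lemma pw_trans_comp:
  assumes "pw_trans f A" "pw_trans g B"
  shows "pw_trans (\<lambda>x. g (f x)) (A \<inter> f -` B)"
  using assms(1)
proof (induction rule: pw_trans.induct)
  case (insert A a b c)
  have "pw_trans (\<lambda>x. g (f x)) ({a..<b} \<inter> f -` B)"
    using assms(2)
  proof (induction rule: pw_trans.induct)
    case (insert B u v d)
    have *: "{a..<b} \<inter> f -` (B \<union> {u..<v}) = ({a..<b} \<inter> f -` B) \<union> {max a (u - c)..<min b (v - c)}"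
      using \<open>\<And>x. x \<in> {a..<b} \<Longrightarrow> f x = x + c\<close> by auto
    show ?case unfolding *
      by (rule pw_trans.insert[where c = "c + d", OF insert.IH])
        (use insert.hyps \<open>\<And>x. x \<in> {a..<b} \<Longrightarrow> f x = x + c\<close> in auto)
  qed (simp add: pw_trans.empty)
  then show ?case using insert.IH by (simp add: Int_Un_distrib2 pw_trans_Un)
qed (simp add: pw_trans.empty)

lemma elementary_vimage: "pw_trans f A \<Longrightarrow> elementary B \<Longrightarrow> elementary (A \<inter> f -` B)"
  using pw_trans_comp pw_trans_elementary by blast

lemma image_translation:
  fixes f :: "real \<Rightarrow> real"
  assumes "\<And>x. x \<in> {a..<b} \<Longrightarrow> f x = x + c"
  shows "f ` {a..<b} = {a + c..<b + c}"
proof -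
  have "f ` {a..<b} = (\<lambda>x. x + c) ` {a..<b}" using assms by (intro image_cong) auto
  also have "\<dots> = {a + c..<b + c}" by (simp add: add.commute)
  finally show ?thesis .
qed

lemma pw_trans_inverse: "pw_trans f A \<Longrightarrow> (\<And>x. x \<in> A \<Longrightarrow> g (f x) = x) \<Longrightarrow> pw_trans g (f ` A)"
proof (induction rule: pw_trans.induct)
  case (insert A a b c)
  have im: "f ` {a..<b} = {a + c..<b + c}" by (rule image_translation) (use insert in auto)
  have "g y = y + (- c)" if "y \<in> {a + c..<b + c}" for y
  proof -
    have "y - c \<in> {a..<b}" using that by auto
    then show ?thesis using insert.prems[of "y - c"] insert.hyps(2)[of "y - c"] by simp
  qed
  then show ?case using insert by (auto simp: image_Un im intro!: pw_trans.insert[where c = "- c"])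
qed (simp add: pw_trans.empty)

lemma elementary_image: "pw_trans f A \<Longrightarrow> elementary (f ` A)"
proof (induction rule: pw_trans.induct)
  case (insert A a b c)
  have im: "f ` {a..<b} = {a + c..<b + c}" by (rule image_translation) (use insert in auto)
  then show ?case using insert by (auto simp: image_Un im intro: pw_trans_Un)
qed (simp add: pw_trans.empty)

text \<open>The displacement is constant on each piece, so \<open>P\<close> can be arbitrary.
  Applied to a map or its powers, this yields the moved points, the points moved to the right, the
  periodic points and the minima of orbits as elementary sets.\<close>

lemma elementary_displacement: "pw_trans f A \<Longrightarrow> elementary {x \<in> A. P (f x - x)}"
proof (induction rule: pw_trans.induct)
  case (insert A a b c)
  have "{x \<in> {a..<b}. P (f x - x)} = (if P c then {a..<b} else {})" using insert.hyps by auto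
  moreover have "{x \<in> A \<union> {a..<b}. P (f x - x)} = {x \<in> A. P (f x - x)} \<union> {x \<in> {a..<b}. P (f x - x)}"
    by auto
  ultimately show ?case using insert.IH by (simp add: pw_trans_Un)
qed (simp add: pw_trans.empty)

text \<open>Every point has an interval to its right inside the half-open piece containing it; this
  is what gives a nonempty elementary set positive measure.\<close>

lemma elementary_right_open:
  "elementary A \<Longrightarrow> x \<in> A \<Longrightarrow> \<exists>y>x. {x..<y} \<subseteq> A"
proof (induction rule: pw_trans.induct)
  case (insert A a b c)
  show ?case
  proof (cases "x \<in> A")
    case True
    then show ?thesis using insert.IH by blast
  next
    case False
    then have "x \<in> {a..<b}" using insert by auto
    then show ?thesis by (intro exI[of _ b]) auto
  qed
qed simp

section \<open>Lebesgue measure of elementary sets\<close>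

lemma elementary_lmeasurable [simp]: "elementary A \<Longrightarrow> A \<in> lmeasurable"
proof (induction rule: pw_trans.induct)
  case (insert A a b c)
  have "{a..<b} \<in> lmeasurable"
    by (rule fmeasurableI2[of "{a..b}"]) auto
  then show ?case using insert.IH by (rule fmeasurable.Un[rotated])
qed simp

lemma measure_interval: "a \<le> b \<Longrightarrow> measure lebesgue {a..<b} = b - (a::real)"
  by (simp add: measure_completion)

lemma elementary_null_empty:
  assumes "elementary A" "measure lebesgue A = 0" shows "A = {}"
proof (rule ccontr)
  assume "A \<noteq> {}"
  then obtain x y where "y > x" "{x..<y} \<subseteq> A" using elementary_right_open assms(1) by blast
  then have "y - x \<le> measure lebesgue A"
    using measure_mono_fmeasurable[of "{x..<y}" A lebesgue] assms(1) by (simp add: measure_interval)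
  then show False using assms \<open>y > x\<close> by simp
qed

text \<open>The difference is elementary and null, hence empty. This turns injectivity into
  surjectivity: an injective piecewise translation into a set of the same measure is onto.\<close>

lemma elementary_eqI:
  assumes "elementary A" "elementary B" "A \<subseteq> B" "measure lebesgue B \<le> measure lebesgue A"
  shows "A = B"
proof -
  have "measure lebesgue (B - A) = measure lebesgue B - measure lebesgue A"
    using assms by (intro measurable_measure_Diff) (auto simp: fmeasurableD)
  then have "measure lebesgue (B - A) = 0"
    using assms(4) measure_nonneg[of lebesgue "B - A"] by linarith
  then show ?thesis using elementary_null_empty[OF pw_trans_Diff[OF assms(2,1)]] assms(3) by auto
qed

lemma measure_image:
  "pw_trans f A \<Longrightarrow> inj_on f A \<Longrightarrow> measure lebesgue (f ` A) = measure lebesgue A"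
proof (induction rule: pw_trans.induct)
  case (insert A a b c)
  \<comment> \<open>The new interval may overlap \<open>A\<close>; only the part outside
    \<open>A\<close> contributes, and there \<open>f\<close> is a single translation.\<close>
  let ?R = "{a..<b} - A"
  have eA: "elementary A" using insert.hyps pw_trans_elementary by blast
  have eR: "elementary ?R" using pw_trans_Diff[OF elementary_interval eA] .
  have pR: "pw_trans f ?R"
    using pw_trans_subset[OF pw_trans_interval[of a b f c] eR] insert.hyps by auto
  have im: "f ` ?R = (\<lambda>x. c + x) ` ?R" using insert.hyps by (intro image_cong) auto
  have "measure lebesgue (f ` ?R) = measure lebesgue ?R"
    unfolding im by (rule measure_translation)
  moreover have "measure lebesgue (f ` (A \<union> ?R)) = measure lebesgue (f ` A) + measure lebesgue (f ` ?R)"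
    unfolding image_Un
  proof (rule measure_Un3[THEN trans])
    show "f ` A \<in> lmeasurable" "f ` ?R \<in> lmeasurable"
      using insert.hyps(1) pR elementary_image elementary_lmeasurable by blast+
    have "f ` A \<inter> f ` ?R = {}" using insert.prems by (auto simp: inj_on_def)
    then show "measure lebesgue (f ` A) + measure lebesgue (f ` ?R) - measure lebesgue (f ` A \<inter> f ` ?R) =
       measure lebesgue (f ` A) + measure lebesgue (f ` ?R)" by simp
  qed
  moreover have "measure lebesgue (A \<union> ?R) = measure lebesgue A + measure lebesgue ?R"
    using eA eR by (subst measure_Un3) (auto simp del: Un_Diff_cancel)
  moreover have "measure lebesgue (f ` A) = measure lebesgue A"
    using insert by (auto simp: inj_on_Un)
  moreover have "A \<union> ?R = A \<union> {a..<b}" by auto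
  ultimately show ?case by metis
qed simp

section \<open>Inverting, gluing and rearranging piecewise translations\<close>

lemma pw_trans_inv_into:
  assumes "pw_trans f A" "bij_betw f A B"
  shows "pw_trans (inv_into A f) B" "bij_betw (inv_into A f) B A"
proof -
  have "pw_trans (inv_into A f) (f ` A)"
    by (rule pw_trans_inverse[OF assms(1)]) (use assms(2) in \<open>auto simp: bij_betw_def\<close>)
  then show "pw_trans (inv_into A f) B" using assms(2) by (simp add: bij_betw_def)
  show "bij_betw (inv_into A f) B A" using assms(2) by (rule bij_betw_inv_into)
qed

lemma pw_trans_compose:
  assumes "pw_trans f A" "f ` A \<subseteq> B" "pw_trans g B"
  shows "pw_trans (\<lambda>x. g (f x)) A"
proof -
  have "A \<inter> f -` B = A" using assms(2) by auto
  then show ?thesis using pw_trans_comp[OF assms(1,3)] by simp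
qed

lemma bij_betw_glue:
  assumes "bij_betw f A A'" "bij_betw g B B'" "A \<inter> B = {}" "A' \<inter> B' = {}"
  shows "bij_betw (\<lambda>x. if x \<in> A then f x else g x) (A \<union> B) (A' \<union> B')"
proof (rule bij_betw_combine)
  show "bij_betw (\<lambda>x. if x \<in> A then f x else g x) A A'"
    using assms(1) by (simp cong: bij_betw_cong)
  have "bij_betw (\<lambda>x. if x \<in> A then f x else g x) B B' \<longleftrightarrow> bij_betw g B B'"
    using assms(3) by (intro bij_betw_cong) auto
  then show "bij_betw (\<lambda>x. if x \<in> A then f x else g x) B B'" using assms(2) by simp
qed (rule assms)

lemma pw_trans_glue:
  assumes "pw_trans f A" "pw_trans g B" "A \<inter> B = {}"
  shows "pw_trans (\<lambda>x. if x \<in> A then f x else g x) (A \<union> B)"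
proof (rule pw_trans_Un)
  show "pw_trans (\<lambda>x. if x \<in> A then f x else g x) A"
    by (rule pw_trans_cong[OF assms(1)]) auto
  show "pw_trans (\<lambda>x. if x \<in> A then f x else g x) B"
    by (rule pw_trans_cong[OF assms(2)]) (use assms(3) in auto)
qed

lemma lebesgue_Un_disjoint:
  "elementary A \<Longrightarrow> elementary B \<Longrightarrow> A \<inter> B = {} \<Longrightarrow>
    measure lebesgue (A \<union> B) = measure lebesgue A + measure lebesgue B"
  by (simp add: measure_Un3)

lemma lebesgue_mono:
  "elementary A \<Longrightarrow> elementary B \<Longrightarrow> A \<subseteq> B \<Longrightarrow> measure lebesgue A \<le> measure lebesgue B"
  by (intro measure_mono_fmeasurable) (auto simp: fmeasurableD)

lemma lebesgue_Diff:
  "elementary A \<Longrightarrow> elementary B \<Longrightarrow> B \<subseteq> A \<Longrightarrow>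
    measure lebesgue (A - B) = measure lebesgue A - measure lebesgue B"
  by (intro measurable_measure_Diff) (auto simp: fmeasurableD)

text \<open>The measure of the part of \<open>A\<close> to the left of \<open>x\<close>, as a function of \<open>x\<close>, squeezes out the
  gaps of \<open>A\<close>.\<close>

lemma pw_trans_onto_interval:
  assumes A: "elementary A"
  obtains f where "pw_trans f A" "bij_betw f A {0..<measure lebesgue A}"
proof -
  define F where "F x = measure lebesgue (A \<inter> {..<x})" for x
  have m: "A \<inter> {..<x} \<in> lmeasurable" for x
    using A by (intro fmeasurable_Int_fmeasurable) auto
  have i: "{x..<y} \<in> lmeasurable" for x y :: real by (rule elementary_lmeasurable) simp
  have step: "F y = F x + (y - x)" if "x \<le> y" "{x..<y} \<subseteq> A" for x y
  proof -
    have "A \<inter> {..<y} = (A \<inter> {..<x}) \<union> {x..<y}" using that by auto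
    moreover have "measure lebesgue ((A \<inter> {..<x}) \<union> {x..<y}) = F x + measure lebesgue {x..<y}"
    proof -
      have "A \<inter> {..<x} \<inter> {x..<y} = {}" by auto
      then show ?thesis unfolding F_def using m i by (subst measure_Un3) auto
    qed
    ultimately show ?thesis using that by (simp add: F_def measure_interval)
  qed
  have mono: "F x \<le> F y" if "x \<le> y" for x y
    unfolding F_def by (rule measure_mono_fmeasurable) (use that m fmeasurableD in auto)
  have bd: "F x \<le> measure lebesgue A" for x
    unfolding F_def by (rule measure_mono_fmeasurable) (use m A fmeasurableD in auto)
  have *: "pw_trans F A'" if "elementary A'" "A' \<subseteq> A" for A'
    using that
  proof (induction rule: pw_trans.induct)
    case (insert A' a b c)
    show ?case
    proof (rule pw_trans.insert[where c = "F a - a"])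
      show "pw_trans F A'" using insert by auto
      fix x assume "x \<in> {a..<b}"
      then show "F x = x + (F a - a)" using step[of a x] insert.prems
        by (auto simp: subset_iff)
    qed
  qed (rule pw_trans.empty)
  have pw: "pw_trans F A" using *[OF A] by simp
  have right: "\<exists>z>x. z \<le> y \<and> F z > F x" if "x \<in> A" "x < y" for x y
  proof -
    obtain z where z: "z > x" "{x..<z} \<subseteq> A"
      using elementary_right_open[OF A \<open>x \<in> A\<close>] by auto
    then have "{x..<min z y} \<subseteq> A" by (auto simp: subset_iff)
    then have "F (min z y) = F x + (min z y - x)" using step[of x "min z y"] that z by auto
    then show ?thesis using z that by (intro exI[of _ "min z y"]) auto
  qed
  have less: "F x < F y" if "x \<in> A" "x < y" for x y
    using right[OF that] mono by (meson order_less_le_trans)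
  have inj: "inj_on F A"
    by (rule linorder_inj_onI) (use less in force)+
  have "F ` A \<subseteq> {0..<measure lebesgue A}"
  proof clarify
    fix x assume "x \<in> A"
    then have "F x < measure lebesgue A" using less[of x "x + 1"] bd[of "x + 1"] by simp
    then show "F x \<in> {0..<measure lebesgue A}" by (simp add: F_def)
  qed
  \<comment> \<open>The image is an elementary subset of full measure, which gives surjectivity
    without solving for preimages.\<close>
  then have "F ` A = {0..<measure lebesgue A}"
    by (intro elementary_eqI) (auto simp: elementary_image pw measure_image[OF pw inj] measure_interval)
  then show ?thesis using that pw inj by (auto simp: bij_betw_def)
qed

text \<open>Both sets can be rearranged onto the same interval starting at 0. Measure is thus the
  only invariant of an elementary set under piecewise translations.\<close>

lemma pw_trans_onto:
  assumes "elementary A" "elementary B" "measure lebesgue A = measure lebesgue B"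
  obtains f where "pw_trans f A" "bij_betw f A B"
proof -
  obtain f where f: "pw_trans f A" "bij_betw f A {0..<measure lebesgue A}"
    using pw_trans_onto_interval[OF assms(1)] .
  obtain g where g: "pw_trans g B" "bij_betw g B {0..<measure lebesgue A}"
    using pw_trans_onto_interval[OF assms(2)] assms(3) by metis
  note g' = pw_trans_inv_into[OF g]
  have "pw_trans (\<lambda>x. inv_into B g (f x)) A"
    using pw_trans_compose[OF f(1) _ g'(1)] f(2) by (simp add: bij_betw_def)
  moreover have "bij_betw (\<lambda>x. inv_into B g (f x)) A B"
    using bij_betw_trans[OF f(2) g'(2)] by (simp add: o_def)
  ultimately show ?thesis by (rule that)
qed

lemma elementary_subset_of_measure:
  assumes "elementary A" "0 \<le> t" "t \<le> measure lebesgue A"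
  obtains B where "elementary B" "B \<subseteq> A" "measure lebesgue B = t"
proof -
  obtain f where f: "pw_trans f A" "bij_betw f A {0..<measure lebesgue A}"
    using pw_trans_onto_interval[OF assms(1)] .
  note g = pw_trans_inv_into[OF f]
  let ?g = "inv_into A f"
  have sub: "{0..<t} \<subseteq> {0..<measure lebesgue A}" using assms by auto
  have pg: "pw_trans ?g {0..<t}" by (rule pw_trans_subset[OF g(1) _ sub]) simp
  have "inj_on ?g {0..<t}" by (rule inj_on_subset[OF bij_betw_imp_inj_on[OF g(2)] sub])
  then have "measure lebesgue (?g ` {0..<t}) = t"
    using measure_image[OF pg] assms by (simp add: measure_interval)
  moreover have "?g ` {0..<t} \<subseteq> A" using g(2) sub by (auto simp: bij_betw_def)
  ultimately show ?thesis using that elementary_image[OF pg] by auto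
qed

section \<open>Interval exchanges as permutations of the line\<close>

text \<open>Interval exchanges as permutations of the whole line: composition and inversion are then those
  of functions, and restriction to \<open>[0,1]\<close> identifies them with the elements of \<^const>\<open>IET\<close>.\<close>

definition exchange :: "(real \<Rightarrow> real) \<Rightarrow> bool" where
  "exchange f \<longleftrightarrow> bij f \<and> (\<forall>x. x \<notin> {0..<1} \<longrightarrow> f x = x) \<and> pw_trans f {0..<1}"

text \<open>The notation \<open>inv\<close> is taken by group inversion.\<close>

abbreviation finv :: "(real \<Rightarrow> real) \<Rightarrow> real \<Rightarrow> real" where
  "finv \<equiv> inv_into UNIV"

lemma exchange_bij: "exchange f \<Longrightarrow> bij f"
  by (simp add: exchange_def)

lemma exchange_outside: "exchange f \<Longrightarrow> x \<notin> {0..<1} \<Longrightarrow> f x = x"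
  unfolding exchange_def by blast

lemma exchange_inj [simp]: "exchange f \<Longrightarrow> f x = f y \<longleftrightarrow> x = y"
  using exchange_bij bij_def inj_eq by metis

lemma exchange_inj_on: "exchange f \<Longrightarrow> inj_on f A"
  by (simp add: inj_on_def)

lemma exchange_inv_f [simp]: "exchange f \<Longrightarrow> finv f (f x) = x"
  by (simp add: inv_f_f exchange_inj_on)

lemma exchange_f_inv [simp]: "exchange f \<Longrightarrow> f (finv f x) = x"
  using exchange_bij bij_is_surj surj_f_inv_f by metis

lemma exchange_mem: "exchange f \<Longrightarrow> f x \<in> {0..<1} \<longleftrightarrow> x \<in> {0..<1}"
proof
  assume f: "exchange f"
  show "x \<in> {0..<1}" if "f x \<in> {0..<1}"
    using that exchange_outside[OF f, of x] by (metis (full_types))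
  show "f x \<in> {0..<1}" if "x \<in> {0..<1}"
    using that exchange_outside[OF f, of "f x"] exchange_inj[OF f] by (metis (full_types))
qed

lemma exchange_image_unit: "exchange f \<Longrightarrow> f ` {0..<1} = {0..<1}"
proof (intro equalityI subsetI)
  fix y :: real assume f: "exchange f" and y: "y \<in> {0..<1}"
  then have "finv f y \<in> {0..<1}" using exchange_mem[OF f, of "finv f y"] by simp
  then show "y \<in> f ` {0..<1}" using f by (metis exchange_f_inv imageI)
qed (use exchange_mem in blast)

lemma exchange_pw_trans: "exchange f \<Longrightarrow> elementary A \<Longrightarrow> A \<subseteq> {0..<1} \<Longrightarrow> pw_trans f A"
  unfolding exchange_def using pw_trans_subset by blast

lemma exchange_elementary_image: "exchange f \<Longrightarrow> elementary A \<Longrightarrow> A \<subseteq> {0..<1} \<Longrightarrow> elementary (f ` A)"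
  using exchange_pw_trans elementary_image by blast

lemma exchange_image_subset: "exchange f \<Longrightarrow> A \<subseteq> {0..<1} \<Longrightarrow> f ` A \<subseteq> {0..<1}"
  using exchange_image_unit by blast

lemma exchange_measure_image:
  "exchange f \<Longrightarrow> elementary A \<Longrightarrow> A \<subseteq> {0..<1} \<Longrightarrow> measure lebesgue (f ` A) = measure lebesgue A"
  by (rule measure_image) (auto simp: exchange_pw_trans exchange_inj_on)

lemma exchange_id [simp]: "exchange id"
  unfolding exchange_def by (auto intro!: pw_trans_interval[where c = 0])

lemma exchange_comp [simp]: assumes "exchange f" "exchange g" shows "exchange (f \<circ> g)"
  unfolding exchange_def
proof (intro conjI allI impI)
  show "bij (f \<circ> g)" using assms by (simp add: bij_comp exchange_bij)
  show "(f \<circ> g) x = x" if "x \<notin> {0..<1}" for x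
    using exchange_outside[OF assms(1) that] exchange_outside[OF assms(2) that] by simp
  show "pw_trans (f \<circ> g) {0..<1}"
    using pw_trans_compose[of g "{0..<1}" "{0..<1}" f] assms exchange_image_unit
    by (simp add: exchange_def o_def)
qed

lemma exchange_inv [simp]: assumes "exchange f" shows "exchange (finv f)"
  unfolding exchange_def
proof (intro conjI allI impI)
  show "bij (finv f)" using assms by (simp add: bij_imp_bij_inv exchange_bij)
  show "finv f x = x" if "x \<notin> {0..<1}" for x
    using exchange_outside[OF assms that] exchange_inv_f[OF assms, of x] by simp
  show "pw_trans (finv f) {0..<1}"
    using pw_trans_inverse[of f "{0..<1}" "finv f"] assms exchange_image_unit[OF assms]
    by (simp add: exchange_def)
qed

lemma exchange_funpow [simp]: "exchange f \<Longrightarrow> exchange (f ^^ n)"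
  by (induction n) auto

definition moved :: "(real \<Rightarrow> real) \<Rightarrow> real set" where
  "moved f = {x. f x \<noteq> x}"

lemma moved_subset: "exchange f \<Longrightarrow> moved f \<subseteq> {0..<1}"
  unfolding moved_def using exchange_outside by blast

lemma elementary_moved: "exchange f \<Longrightarrow> elementary (moved f)"
proof -
  assume f: "exchange f"
  then have "elementary {x \<in> {0..<1}. f x - x \<noteq> 0}"
    by (intro elementary_displacement) (simp add: exchange_def)
  moreover have "moved f = {x \<in> {0..<1}. f x - x \<noteq> 0}"
    using moved_subset[OF f] by (auto simp: moved_def)
  ultimately show ?thesis by simp
qed

lemma moved_conj: "exchange w \<Longrightarrow> moved (w \<circ> f \<circ> finv w) = w ` moved f"
proof (intro equalityI subsetI)
  fix x assume w: "exchange w" and "x \<in> moved (w \<circ> f \<circ> finv w)"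
  then have "finv w x \<in> moved f" by (auto simp: moved_def)
  then show "x \<in> w ` moved f" using w by (metis exchange_f_inv imageI)
qed (auto simp: moved_def)

lemma exchange_extend:
  assumes "pw_trans f {0..<1}" "bij_betw f {0..<1} {0..<1}"
  shows "exchange (\<lambda>x. if x \<in> {0..<1} then f x else x)"
  unfolding exchange_def
proof (intro conjI allI impI)
  have "bij_betw (\<lambda>x. if x \<in> {0..<1} then f x else x) ({0..<1} \<union> - {0..<1}) ({0..<1} \<union> - {0..<1})"
    by (rule bij_betw_glue[OF assms(2)]) (auto simp: bij_betw_def)
  then show "bij (\<lambda>x. if x \<in> {0..<1} then f x else x)" by (simp only: Compl_partition)
  show "pw_trans (\<lambda>x. if x \<in> {0..<1} then f x else x) {0..<1}"
    by (rule pw_trans_cong[OF assms(1)]) simp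
  show "(if x \<in> {0..<1} then f x else x) = x" if "x \<notin> {0..<1}" for x
    using that by (simp only: if_False)
qed

text \<open>The complements of \<open>A\<close> and \<open>B\<close> in the unit interval also have
  equal measure, so a rearrangement of the sets and one of the complements glue to an
  exchange.\<close>

lemma exchange_transport:
  assumes "elementary A" "elementary B" "A \<subseteq> {0..<1}" "B \<subseteq> {0..<1}"
    "measure lebesgue A = measure lebesgue B"
  obtains w where "exchange w" "w ` A = B"
proof -
  obtain f where f: "pw_trans f A" "bij_betw f A B" using pw_trans_onto[OF assms(1,2,5)] .
  have c: "elementary ({0..<1} - A)" "elementary ({0..<1} - B)" by (simp_all add: pw_trans_Diff assms)
  have "measure lebesgue ({0..<1} - A) = measure lebesgue ({0..<1} - B)"
    using assms by (simp add: lebesgue_Diff)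
  then obtain g where g: "pw_trans g ({0..<1} - A)" "bij_betw g ({0..<1} - A) ({0..<1} - B)"
    using pw_trans_onto[OF c] by blast
  let ?h = "\<lambda>x. if x \<in> A then f x else g x"
  have u: "A \<union> ({0..<1} - A) = {0..<1}" "B \<union> ({0..<1} - B) = {0..<1}" using assms by auto
  have "pw_trans ?h {0..<1}" using pw_trans_glue[OF f(1) g(1)] u by simp
  moreover have "bij_betw ?h {0..<1} {0..<1}" using bij_betw_glue[OF f(2) g(2)] u by simp
  ultimately have "exchange (\<lambda>x. if x \<in> {0..<1} then ?h x else x)" by (rule exchange_extend)
  moreover have "(\<lambda>x. if x \<in> {0..<1} then ?h x else x) ` A = f ` A"
    using assms(3) by (intro image_cong) auto
  ultimately show ?thesis using that f(2) by (simp add: bij_betw_def)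
qed

lemma exchange_restrict:
  assumes "exchange t" "elementary S" "S \<subseteq> {0..<1}" "t ` S = S"
  shows "exchange (\<lambda>x. if x \<in> S then t x else x)"
  unfolding exchange_def
proof (intro conjI allI impI)
  have "bij_betw (\<lambda>x. if x \<in> S then t x else x) (S \<union> - S) (S \<union> - S)"
    by (rule bij_betw_glue) (use assms in \<open>auto simp: bij_betw_def exchange_inj_on\<close>)
  then show "bij (\<lambda>x. if x \<in> S then t x else x)" by (simp only: Compl_partition)
  show "(if x \<in> S then t x else x) = x" if "x \<notin> {0..<1}" for x using that assms(3) by auto
  have "pw_trans (\<lambda>x. if x \<in> S then t x else x) (S \<union> ({0..<1} - S))"
    by (rule pw_trans_glue) (use assms in \<open>auto simp: exchange_pw_trans pw_trans_Diff\<close>)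
  moreover have "S \<union> ({0..<1} - S) = {0..<1}" using assms(3) by auto
  ultimately show "pw_trans (\<lambda>x. if x \<in> S then t x else x) {0..<1}" by simp
qed

section \<open>Involutions and their conjugacy classes\<close>

lemma exchange_involution:
  assumes "pw_trans s {0..<1}" "\<And>x. x \<notin> {0..<1} \<Longrightarrow> s x = x" "s \<circ> s = id"
  shows "exchange s"
  unfolding exchange_def using assms o_bij by blast

text \<open>An involution exchanges the set of points it moves to the right with the set of points it
  moves to the left.\<close>

lemma involution_halves:
  assumes t: "exchange t" "t \<circ> t = id"
  obtains A where "elementary A" "A \<subseteq> {0..<1}" "elementary (t ` A)" "A \<inter> t ` A = {}"
    "moved t = A \<union> t ` A" "measure lebesgue (moved t) = 2 * measure lebesgue A"
proof -
  have tt: "t (t x) = x" for x using t(2) by (metis comp_apply id_apply)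
  define A where "A = {x \<in> {0..<1}. t x - x > 0}"
  have A: "elementary A" unfolding A_def
    by (intro elementary_displacement) (use t in \<open>simp add: exchange_def\<close>)
  have sub: "A \<subseteq> {0..<1}" by (auto simp: A_def)
  have m: "x \<in> {0..<1}" if "t x \<noteq> x" for x using that exchange_outside[OF t(1)] by blast
  have memA: "x \<in> A \<longleftrightarrow> t x > x" for x using m by (force simp: A_def)
  have memB: "x \<in> t ` A \<longleftrightarrow> t x < x" for x
    using memA tt by (metis imageE imageI)
  have d: "A \<inter> t ` A = {}" using memA memB by force
  have mv: "moved t = A \<union> t ` A" 
    by (rule Set.set_eqI) (unfold Un_iff memA memB moved_def, auto)
  note B = exchange_elementary_image[OF t(1) A sub]
  have "measure lebesgue (moved t) = 2 * measure lebesgue A"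
    unfolding mv using lebesgue_Un_disjoint[OF A B d] exchange_measure_image[OF t(1) A sub] by simp
  then show ?thesis using that A sub B d mv by blast
qed

text \<open>A rearrangement \<open>p\<close> of one half of the support of \<open>t\<close> onto one
  half of that of \<open>t'\<close> can be chosen freely. Equivariance then determines
  \<open>w\<close> on the other half, and on the fixed points any rearrangement onto the fixed
  points of \<open>t'\<close> will do.\<close>

lemma involution_conjugate:
  assumes t: "exchange t" "t \<circ> t = id" and t': "exchange t'" "t' \<circ> t' = id"
    and eq: "measure lebesgue (moved t) = measure lebesgue (moved t')"
  obtains w where "exchange w" "t' = w \<circ> t \<circ> finv w"
proof -
  have tt: "t (t x) = x" "t' (t' x) = x" for x using t(2) t'(2) by (metis comp_apply id_apply)+
  obtain A where A: "elementary A" "A \<subseteq> {0..<1}" "elementary (t ` A)" "A \<inter> t ` A = {}"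
    "moved t = A \<union> t ` A" "measure lebesgue (moved t) = 2 * measure lebesgue A"
    using involution_halves[OF t] .
  obtain A' where A': "elementary A'" "A' \<subseteq> {0..<1}" "elementary (t' ` A')" "A' \<inter> t' ` A' = {}"
    "moved t' = A' \<union> t' ` A'" "measure lebesgue (moved t') = 2 * measure lebesgue A'"
    using involution_halves[OF t'] .
  obtain p where p: "pw_trans p A" "bij_betw p A A'"
    using pw_trans_onto[OF A(1) A'(1)] eq A(6) A'(6) by auto
  let ?C = "{0..<1} - moved t" and ?C' = "{0..<1} - moved t'"
  have eC: "elementary ?C" "elementary ?C'" by (simp_all add: pw_trans_Diff elementary_moved t t')
  have "measure lebesgue ?C = measure lebesgue ?C'"
    using eq moved_subset t t' by (simp add: lebesgue_Diff elementary_moved)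
  then obtain r where r: "pw_trans r ?C" "bij_betw r ?C ?C'"
    using pw_trans_onto[OF eC] by blast
  \<comment> \<open>Forced by the requirement that \<open>w\<close> carry \<open>t\<close> to
    \<open>t'\<close>: a point \<open>t a\<close> must go to \<open>t' (p a)\<close>.\<close>
  let ?q = "\<lambda>x. t' (p (t x))"
  have ttA: "t ` t ` A = A" by (auto simp: image_image tt)
  have sub: "t ` A \<subseteq> {0..<1}" using exchange_image_subset[OF t(1) A(2)] .
  have q1: "pw_trans ?q (t ` A)"
  proof (rule pw_trans_compose[where B = A' and f = "\<lambda>x. p (t x)" and g = t'])
    show "pw_trans (\<lambda>x. p (t x)) (t ` A)"
      by (rule pw_trans_compose[where B = A and f = t and g = p]) (use t A p sub in \<open>auto simp: exchange_pw_trans ttA tt\<close>)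
    show "(\<lambda>x. p (t x)) ` t ` A \<subseteq> A'" using p(2) by (auto simp: tt bij_betw_def)
    show "pw_trans t' A'" using t' A' exchange_pw_trans by blast
  qed
  have q2: "bij_betw ?q (t ` A) (t' ` A')"
  proof -
    have "bij_betw t (t ` A) A" using ttA by (simp add: bij_betw_def exchange_inj_on t)
    moreover have "bij_betw t' A' (t' ` A')" by (simp add: bij_betw_def exchange_inj_on t')
    ultimately have "bij_betw (t' \<circ> (p \<circ> t)) (t ` A) (t' ` A')"
      using p(2) bij_betw_trans by blast
    then show ?thesis by (simp add: o_def)
  qed
  let ?h = "\<lambda>x. if x \<in> A then p x else ?q x"
  let ?k = "\<lambda>x. if x \<in> A \<union> t ` A then ?h x else r x"
  have h: "pw_trans ?h (A \<union> t ` A)" "bij_betw ?h (A \<union> t ` A) (A' \<union> t' ` A')"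
    by (rule pw_trans_glue[OF p(1) q1 A(4)], rule bij_betw_glue[OF p(2) q2 A(4) A'(4)])
  have un: "(A \<union> t ` A) \<union> ?C = {0..<1}" "(A' \<union> t' ` A') \<union> ?C' = {0..<1}"
    using moved_subset[OF t(1)] moved_subset[OF t'(1)] A(5) A'(5) by auto
  have "pw_trans ?k ((A \<union> t ` A) \<union> ?C)"
    by (rule pw_trans_glue[OF h(1) r(1)]) (use A(5) in auto)
  then have k1: "pw_trans ?k {0..<1}" unfolding un .
  have "bij_betw ?k ((A \<union> t ` A) \<union> ?C) ((A' \<union> t' ` A') \<union> ?C')"
    by (rule bij_betw_glue[OF h(2) r(2)]) (use A(5) A'(5) in auto)
  then have k2: "bij_betw ?k {0..<1} {0..<1}" unfolding un .
  define w where "w = (\<lambda>x. if x \<in> {0..<1} then ?k x else x)"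
  have w: "exchange w" unfolding w_def by (rule exchange_extend[OF k1 k2])
  have wA: "w x = p x" if "x \<in> A" for x using that A(2) by (auto simp: w_def)
  have wB: "w x = t' (p (t x))" if "x \<in> t ` A" for x using that sub A(4) by (auto simp: w_def)
  have wC: "w x \<notin> moved t'" if "x \<notin> moved t" for x
  proof (cases "x \<in> {0..<1}")
    case True
    then have "w x = r x" using that A(5) by (simp add: w_def)
    then show ?thesis using r(2) True that by (auto simp: bij_betw_def)
  next
    case False
    then show ?thesis using moved_subset[OF t'(1)] by (auto simp: w_def)
  qed
  have "t' (w x) = w (t x)" for x
  proof -
    consider "x \<in> A" | "x \<in> t ` A" | "x \<notin> moved t" using A(5) by auto
    then show ?thesis
    proof cases
      case 1
      then show ?thesis using wA[OF 1] wB[of "t x"] by (simp add: tt)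
    next
      case 2
      then have "t x \<in> A" using ttA by auto
      then show ?thesis using wB[OF 2] wA[of "t x"] by (simp add: tt)
    next
      case 3
      then show ?thesis using wC[OF 3] by (simp add: moved_def)
    qed
  qed
  then have "t' y = (w \<circ> t \<circ> finv w) y" for y using w by (metis comp_apply exchange_f_inv)
  then show ?thesis using that w by blast
qed

text \<open>The model swaps the two halves of \<open>{0..<\<sigma>}\<close>; an exchange carrying
  this interval onto a subset \<open>D\<close> of \<open>B\<close> of measure \<sigma> conjugates it
  into \<open>B\<close>.\<close>

lemma involution_exists:
  assumes B: "elementary B" "B \<subseteq> {0..<1}" and \<sigma>: "0 \<le> \<sigma>" "\<sigma> \<le> measure lebesgue B"
  obtains s where "exchange s" "s \<circ> s = id" "moved s \<subseteq> B" "measure lebesgue (moved s) = \<sigma>"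
proof -
  have "measure lebesgue B \<le> measure lebesgue {0..<1::real}" 
    by (rule lebesgue_mono) (use B in auto)
  then have 1: "\<sigma> \<le> 1" using \<sigma> by (simp add: measure_interval)
  obtain D where D: "elementary D" "D \<subseteq> B" "measure lebesgue D = \<sigma>"
    using elementary_subset_of_measure[OF B(1) \<sigma>] .
  have s0: "{0..<\<sigma>} \<subseteq> {0..<1}" "D \<subseteq> {0..<1}" using 1 D B by auto
  obtain w where w: "exchange w" "w ` {0..<\<sigma>} = D"
    using exchange_transport[of "{0..<\<sigma>}" D] D s0 \<sigma> by (auto simp: measure_interval)
  define s where "s x = (if x \<in> {0..<\<sigma>/2} then x + \<sigma>/2 else if x \<in> {\<sigma>/2..<\<sigma>} then x - \<sigma>/2 else x)" for x
  have ss: "s \<circ> s = id" using \<sigma> by (auto simp: s_def fun_eq_iff)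
  have "pw_trans s ({0..<\<sigma>/2} \<union> {\<sigma>/2..<\<sigma>} \<union> {\<sigma>..<1})"
    by (intro pw_trans_Un pw_trans_interval[where c = "\<sigma>/2"] pw_trans_interval[where c = "-\<sigma>/2"]
        pw_trans_interval[where c = 0]) (use \<sigma> in \<open>auto simp: s_def\<close>)
  moreover have "{0..<\<sigma>/2} \<union> {\<sigma>/2..<\<sigma>} \<union> {\<sigma>..<1} = {0..<1}" using \<sigma> 1 by auto
  ultimately have s: "exchange s" using 1 \<sigma> ss by (intro exchange_involution) (auto simp: s_def)
  have mv: "moved s = {0..<\<sigma>}" using \<sigma> by (auto simp: moved_def s_def)
  show ?thesis
  proof
    show "exchange (w \<circ> s \<circ> finv w)" using w s by simp
    show "(w \<circ> s \<circ> finv w) \<circ> (w \<circ> s \<circ> finv w) = id"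
      using w(1) ss by (auto simp: fun_eq_iff)
    show "moved (w \<circ> s \<circ> finv w) \<subseteq> B" using moved_conj[OF w(1)] mv w(2) D by simp
    show "measure lebesgue (moved (w \<circ> s \<circ> finv w)) = \<sigma>"
      using moved_conj[OF w(1)] mv w(2) D by simp
  qed
qed

section \<open>Periodic approximation\<close>

text \<open>Where \<open>g\<close> is a translation by \<open>c\<close>, a half-open interval of
  length at most \<open>\<bar>c\<bar>\<close> is moved off itself. Each piece is cut into finitely
  many of these; \<open>c\<close> is nonzero because \<open>g\<close> has no fixed point in
  \<open>Y\<close>.\<close>

lemma displaced_cover:
  "pw_trans g Y \<Longrightarrow> (\<And>x. x \<in> Y \<Longrightarrow> g x \<noteq> x) \<Longrightarrow>
    \<exists>F. finite F \<and> Y = \<Union>F \<and> (\<forall>J\<in>F. elementary J \<and> g ` J \<inter> J = {})"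
proof (induction rule: pw_trans.induct)
  case empty
  show ?case by (intro exI[of _ "{}"]) simp
next
  case (insert Y a b c)
  then obtain F where F: "finite F" "Y = \<Union>F" "\<forall>J\<in>F. elementary J \<and> g ` J \<inter> J = {}" by auto
  show ?case
  proof (cases "a < b")
    case False
    then show ?thesis using F by (intro exI[of _ F]) auto
  next
    case True
    then have c: "\<bar>c\<bar> > 0" using insert.hyps(2)[of a] insert.prems[of a] by auto
    define J where "J k = {a..<b} \<inter> {a + real k * \<bar>c\<bar>..<a + real (Suc k) * \<bar>c\<bar>}" for k
    define n where "n = Suc (nat \<lceil>(b - a) / \<bar>c\<bar>\<rceil>)"
    have "elementary (J k)" for k unfolding J_def by (rule pw_trans_Int) auto
    moreover have "g ` J k \<inter> J k = {}" for k
    proof -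
      have "g x \<notin> J k" if "x \<in> J k" for x
      proof -
        have "g x = x + c" using that insert.hyps(2)[of x] unfolding J_def by blast
        then show ?thesis using that by (auto simp: J_def abs_if algebra_simps split: if_splits)
      qed
      then show ?thesis by blast
    qed
    moreover have "{a..<b} = \<Union>(J ` {..<n})"
    proof (intro equalityI subsetI)
      fix x assume x: "x \<in> {a..<b}"
      define k where "k = nat \<lfloor>(x - a) / \<bar>c\<bar>\<rfloor>"
      have q: "0 \<le> (x - a) / \<bar>c\<bar>" "(x - a) / \<bar>c\<bar> \<le> (b - a) / \<bar>c\<bar>"
        using x c by (auto intro: divide_right_mono)
      have "real k \<le> (x - a) / \<bar>c\<bar>" "(x - a) / \<bar>c\<bar> < real (Suc k)"
        unfolding k_def using q by linarith+
      then have "x \<in> J k" using x c by (auto simp: J_def field_simps)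
      moreover have "k < n" unfolding k_def n_def using q by linarith
      ultimately show "x \<in> \<Union>(J ` {..<n})" by blast
    next
      fix x assume "x \<in> \<Union>(J ` {..<n})"
      then show "x \<in> {a..<b}" unfolding J_def by blast
    qed
    ultimately have "finite (F \<union> J ` {..<n}) \<and> Y \<union> {a..<b} = \<Union>(F \<union> J ` {..<n}) \<and>
      (\<forall>K\<in>F \<union> J ` {..<n}. elementary K \<and> g ` K \<inter> K = {})"
      using F by (simp add: ball_Un)
    then show ?thesis by (rule exI)
  qed
qed

lemma displaced_cover_funpow:
  assumes h: "exchange h" and Y: "elementary Y" "Y \<subseteq> {0..<1}"
    and np: "\<And>x p. x \<in> Y \<Longrightarrow> p \<in> {1..N} \<Longrightarrow> (h ^^ p) x \<noteq> x"
  shows "\<exists>F. finite F \<and> Y = \<Union>F \<and>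
    (\<forall>J\<in>F. elementary J \<and> (\<forall>p\<in>{1..N}. (h ^^ p) ` J \<inter> J = {}))"
  using np
proof (induction N)
  case 0
  show ?case by (intro exI[of _ "{Y}"]) (simp add: Y)
next
  case (Suc N)
  then obtain F where F: "finite F" "Y = \<Union>F"
    "\<And>J. J \<in> F \<Longrightarrow> elementary J"  "\<And>J p. J \<in> F \<Longrightarrow> p \<in> {1..N} \<Longrightarrow> (h ^^ p) ` J \<inter> J = {}"
    by fastforce
  have "pw_trans (h ^^ Suc N) Y"
    using exchange_pw_trans[OF exchange_funpow[OF h]] Y by blast
  moreover have "(h ^^ Suc N) x \<noteq> x" if "x \<in> Y" for x
    by (rule Suc.prems[OF that]) simp
  ultimately have "\<exists>G. finite G \<and> Y = \<Union>G \<and> (\<forall>J\<in>G. elementary J \<and> (h ^^ Suc N) ` J \<inter> J = {})"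
    by (rule displaced_cover)
  then obtain G where
    G: "finite G" "Y = \<Union>G" "\<And>J. J \<in> G \<Longrightarrow> elementary J" "\<And>J. J \<in> G \<Longrightarrow> (h ^^ Suc N) ` J \<inter> J = {}"
    by blast
  \<comment> \<open>The common refinement of the two covers: being disjoint from an iterate passes
    to subsets.\<close>
  let ?H = "(\<lambda>(J, K). J \<inter> K) ` (F \<times> G)"
  have "elementary (J \<inter> K) \<and> (\<forall>p\<in>{1..Suc N}. (h ^^ p) ` (J \<inter> K) \<inter> (J \<inter> K) = {})"
    if "J \<in> F" "K \<in> G" for J K
  proof (intro conjI ballI)
    show "elementary (J \<inter> K)" by (rule pw_trans_Int[OF F(3)[OF that(1)] G(3)[OF that(2)]])
    fix p assume "p \<in> {1..Suc N}"
    then consider "p \<in> {1..N}" | "p = Suc N" by (cases "p = Suc N") auto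
    then show "(h ^^ p) ` (J \<inter> K) \<inter> (J \<inter> K) = {}"
      using F(4)[of J p] G(4)[of K] that by cases blast+
  qed
  moreover have "Y = \<Union>?H" using F(2) G(2) by auto
  ultimately show ?case using F(1) G(1) by (intro exI[of _ ?H]) auto
qed

text \<open>A greedy choice over a cover by sets disjoint from their first \<open>N\<close> iterates.\<close>

lemma marker_set:
  assumes h: "exchange h" and Y: "elementary Y" "Y \<subseteq> {0..<1}"
    and np: "\<And>x p. x \<in> Y \<Longrightarrow> p \<in> {1..N} \<Longrightarrow> (h ^^ p) x \<noteq> x"
  obtains B where "elementary B" "B \<subseteq> Y" "\<And>p. p \<in> {1..N} \<Longrightarrow> (h ^^ p) ` B \<inter> B = {}"
    "\<And>x. x \<in> Y \<Longrightarrow> \<exists>i\<le>N. (h ^^ i) x \<in> B \<or> x \<in> (h ^^ i) ` B"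
proof -
  obtain F where F: "finite F" "Y = \<Union>F"
    "\<And>J. J \<in> F \<Longrightarrow> elementary J"  "\<And>J p. J \<in> F \<Longrightarrow> p \<in> {1..N} \<Longrightarrow> (h ^^ p) ` J \<inter> J = {}"
    using displaced_cover_funpow[OF h Y, of N] np by auto
  have "\<exists>B. elementary B \<and> B \<subseteq> \<Union>F \<and> (\<forall>p\<in>{1..N}. (h ^^ p) ` B \<inter> B = {}) \<and>
     (\<forall>x\<in>\<Union>F. \<exists>i\<le>N. (h ^^ i) x \<in> B \<or> x \<in> (h ^^ i) ` B)" if "\<Union>F \<subseteq> Y"
    using F(1) that F(3,4)
  proof (induction rule: finite_induct)
    case empty
    show ?case by (intro exI[of _ "{}"]) (simp add: pw_trans.empty)
  next
    case (insert J F)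
    have "\<Union>F \<subseteq> Y" using insert.prems(1) by auto
    from insert.IH[OF this insert.prems(2,3)] obtain B where B0: "elementary B" "B \<subseteq> \<Union>F"
      "\<forall>p\<in>{1..N}. (h ^^ p) ` B \<inter> B = {}"
      "\<forall>x\<in>\<Union>F. \<exists>i\<le>N. (h ^^ i) x \<in> B \<or> x \<in> (h ^^ i) ` B"
      by blast
    note B = B0(1,2) bspec[OF B0(3)] bspec[OF B0(4)]
    have B01: "B \<subseteq> {0..<1}" 
      using B(2) \<open>\<Union>F \<subseteq> Y\<close> Y(2) by (meson order_trans)
    have J: "elementary J" "J \<subseteq> {0..<1}"
      using insert.prems(1) insert.prems(2)[of J] Y(2) by auto
    \<comment> \<open>\<open>V\<close> consists of the points at most \<open>N\<close> steps from
      \<open>B\<close> along their orbit, in either direction. The part of \<open>J\<close> in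
      \<open>V\<close> already satisfies the covering condition; the part outside \<open>V\<close>
      can be added.\<close>
    define V where "V = (\<Union>i\<in>{..N}. (h ^^ i) ` B \<union> ({0..<1} \<inter> (h ^^ i) -` B))"
    have "elementary V" unfolding V_def
    proof (intro pw_trans_UN pw_trans_Un)
      fix i
      show "elementary ((h ^^ i) ` B)" "elementary ({0..<1} \<inter> (h ^^ i) -` B)"
        using exchange_elementary_image[OF exchange_funpow[OF h] B(1) B01]
          elementary_vimage[OF exchange_pw_trans[OF exchange_funpow[OF h]] B(1)] by auto
    qed simp
    have V: "x \<in> V \<longleftrightarrow> (\<exists>i\<le>N. (h ^^ i) x \<in> B \<or> x \<in> (h ^^ i) ` B)" if "x \<in> {0..<1}" for x
      using that by (auto simp: V_def)
    let ?B = "B \<union> (J - V)"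
    have "elementary ?B" using B J \<open>elementary V\<close> by (simp add: pw_trans_Un pw_trans_Diff)
    moreover have "?B \<subseteq> \<Union>(insert J F)" using B(2) by auto
    moreover have "(h ^^ p) ` ?B \<inter> ?B = {}" if p: "p \<in> {1..N}" for p
    proof -
      \<comment> \<open>A collision of \<open>B\<close> with a new point, in either direction, would
        put the new point into \<open>V\<close>. New points do not collide with each other, as
        \<open>J\<close> is disjoint from its first \<open>N\<close> iterates.\<close>
      have 1: "(h ^^ p) x \<notin> J - V" if "x \<in> B" for x
      proof
        assume *: "(h ^^ p) x \<in> J - V"
        then have "(h ^^ p) x \<in> {0..<1}" using J by auto
        then show False using V[of "(h ^^ p) x"] * that p by auto
      qed
      have 2: "(h ^^ p) x \<notin> B" if "x \<in> J - V" for x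
        using V[of x] J that p by auto
      have 3: "(h ^^ p) ` J \<inter> J = {}" using insert.prems(3)[of J p] p by simp
      show ?thesis using 1 2 3 B(3)[OF p] by blast
    qed
    moreover have "\<exists>i\<le>N. (h ^^ i) x \<in> ?B \<or> x \<in> (h ^^ i) ` ?B" if x: "x \<in> \<Union>(insert J F)" for x
    proof -
      consider "x \<in> \<Union>F" | "x \<in> J" "x \<in> V" | "x \<in> J" "x \<notin> V" using x by auto
      then show ?thesis
      proof cases
        case 1
        then show ?thesis using B(4)[of x] by (metis UnI1 image_Un)
      next
        case 2
        then show ?thesis using V[of x] J by (metis UnI1 image_Un subsetD)
      next
        case 3
        then show ?thesis by (intro exI[of _ 0]) simp
      qed
    qed
    ultimately show ?case by blast
  qed
  then obtain B where B: "elementary B" "B \<subseteq> Y" "\<forall>p\<in>{1..N}. (h ^^ p) ` B \<inter> B = {}"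
     "\<forall>x\<in>Y. \<exists>i\<le>N. (h ^^ i) x \<in> B \<or> x \<in> (h ^^ i) ` B" using F(2) by auto
  show ?thesis by (rule that[OF B(1,2) bspec[OF B(3)] bspec[OF B(4)]])
qed

text \<open>Applying the inverse of \<open>h ^^ i\<close> to a meeting of the \<open>i\<close>-th
  and \<open>j\<close>-th images reduces it to one of \<open>B\<close> with its own
  \<open>(j - i)\<close>-th image. As the union lies in the unit interval, this is what makes a
  marker set small.\<close>

lemma measure_UN_images:
  assumes h: "exchange h" and B: "elementary B" "B \<subseteq> {0..<1}"
    and disj: "\<And>p. p \<in> {1..n} \<Longrightarrow> (h ^^ p) ` B \<inter> B = {}"
  shows "measure lebesgue (\<Union>i\<le>n. (h ^^ i) ` B) = real (Suc n) * measure lebesgue B"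
proof -
  have el: "elementary ((h ^^ i) ` B)" for i
    using exchange_elementary_image[OF exchange_funpow[OF h] B] .
  have dj: "(h ^^ i) ` B \<inter> (h ^^ j) ` B = {}" if "i < j" "j \<le> n" for i j
  proof -
    have "(h ^^ i) x \<noteq> (h ^^ j) y" if "x \<in> B" "y \<in> B" for x y
    proof
      assume "(h ^^ i) x = (h ^^ j) y"
      also have "(h ^^ j) y = (h ^^ i) ((h ^^ (j - i)) y)"
        using \<open>i < j\<close> by (metis comp_apply funpow_add le_add_diff_inverse less_imp_le)
      finally have "x = (h ^^ (j - i)) y" using h by simp
      moreover have "j - i \<in> {1..n}" using \<open>i < j\<close> \<open>j \<le> n\<close> by auto
      ultimately show False using disj[of "j - i"] that by blast
    qed
    then show ?thesis by blast
  qed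
  have "measure lebesgue (\<Union>i\<in>{..n}. (h ^^ i) ` B) = (\<Sum>i\<in>{..n}. measure lebesgue ((h ^^ i) ` B))"
  proof (rule measure_UNION')
    show "pairwise (\<lambda>i j. disjnt ((h ^^ i) ` B) ((h ^^ j) ` B)) {..n}"
    proof (rule pairwiseI)
      fix i j assume "i \<in> {..n}" "j \<in> {..n}" "i \<noteq> j"
      then show "disjnt ((h ^^ i) ` B) ((h ^^ j) ` B)"
        using dj[of i j] dj[of j i] by (cases "i < j") (auto simp: disjnt_def)
    qed
  qed (auto simp: el)
  also have "\<dots> = (\<Sum>i\<in>{..n}. measure lebesgue B)"
    by (intro sum.cong refl exchange_measure_image[OF exchange_funpow[OF h] B])
  finally show ?thesis by simp
qed

lemma measure_le_1: "elementary B \<Longrightarrow> B \<subseteq> {0..<1} \<Longrightarrow> measure lebesgue B \<le> 1"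
  using lebesgue_mono[of B "{0..<1}"] by (simp add: measure_interval)

text \<open>Since return times are bounded by \<open>R\<close>, finitely many elementary level sets
  \<open>D k\<close> make up \<open>B\<close>, and on each of them \<open>T\<close> is a power of
  \<open>h\<close>. Thus \<open>T\<close> is a piecewise translation; it is injective because return
  times are least, and then onto \<open>B\<close> because it preserves measure.\<close>

lemma first_return:
  assumes h: "exchange h" and B: "elementary B" "B \<subseteq> {0..<1}"
    and ret: "\<And>b. b \<in> B \<Longrightarrow> \<exists>r\<in>{1..R}. (h ^^ r) b \<in> B"
  obtains T r where "exchange T" "moved T \<subseteq> B" "\<And>b. b \<in> B \<Longrightarrow> r b \<in> {1..R}"
    "\<And>b. b \<in> B \<Longrightarrow> T b = (h ^^ r b) b" "\<And>b. b \<in> B \<Longrightarrow> T b \<in> B"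
    "\<And>b i. b \<in> B \<Longrightarrow> 0 < i \<Longrightarrow> i < r b \<Longrightarrow> (h ^^ i) b \<notin> B"
proof -
  define r where "r b = (LEAST r. 0 < r \<and> (h ^^ r) b \<in> B)" for b
  have r: "0 < r b \<and> (h ^^ r b) b \<in> B" if "b \<in> B" for b
  proof -
    obtain k where "k \<in> {1..R}" "(h ^^ k) b \<in> B" using ret[OF \<open>b \<in> B\<close>] by blast
    then have "\<exists>k. 0 < k \<and> (h ^^ k) b \<in> B" by (intro exI[of _ k]) simp
    then show ?thesis unfolding r_def by (rule LeastI_ex)
  qed
  have rmin: "(h ^^ i) b \<notin> B" if "0 < i" "i < r b" for b i
    using not_less_Least[of i "\<lambda>r. 0 < r \<and> (h ^^ r) b \<in> B"] that by (auto simp: r_def)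
  have rR: "r b \<in> {1..R}" if b: "b \<in> B" for b
  proof -
    obtain k where k: "k \<in> {1..R}" "(h ^^ k) b \<in> B" using ret[OF b] by blast
    then have "r b \<le> k" unfolding r_def by (intro Least_le) auto
    then show ?thesis using k r[OF b] by auto
  qed
  define T where "T x = (if x \<in> B then (h ^^ r x) x else x)" for x
  define D where "D k = (B \<inter> (h ^^ k) -` B) - (\<Union>i\<in>{1..<k}. B \<inter> (h ^^ i) -` B)" for k
  have pwB: "pw_trans (h ^^ i) B" for i using exchange_pw_trans[OF exchange_funpow[OF h] B] .
  have Del: "elementary (D k)" for k
    unfolding D_def by (intro pw_trans_Diff pw_trans_UN elementary_vimage[OF pwB] B) simp
  have Dr: "x \<in> D k \<longleftrightarrow> x \<in> B \<and> r x = k" if "k > 0" for x k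
  proof
    assume x: "x \<in> D k"
    then have "r x = k" unfolding r_def
      by (intro Least_equality) (use that in \<open>force simp: D_def not_less[symmetric]\<close>)+
    then show "x \<in> B \<and> r x = k" using x by (simp add: D_def)
  next
    assume "x \<in> B \<and> r x = k"
    then show "x \<in> D k" using r[of x] rmin[of _ x] by (auto simp: D_def)
  qed
  have pT: "pw_trans T (\<Union>k\<in>{1..R}. D k)"
  proof (rule pw_trans_UN)
    fix k assume "k \<in> {1..R}"
    then show "pw_trans T (D k)"
      using pw_trans_cong[of "h ^^ k" "D k" T] pw_trans_subset[OF pwB Del, of k] Dr[of k]
      by (auto simp: T_def subset_iff)
  qed simp
  have UB: "(\<Union>k\<in>{1..R}. D k) = B" using Dr rR by force
  \<comment> \<open>If two points arrived at the same place after different times, the orbit of the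
    one with the longer time would pass through the other, a point of \<open>B\<close>, before its
    first return.\<close>
  have inj: "inj_on T B"
  proof -
    have *: "x = y" if xy: "x \<in> B" "y \<in> B" "T x = T y" "r x \<le> r y" for x y
    proof -
      have "(h ^^ r x) x = (h ^^ r y) y" using xy by (simp add: T_def)
      also have "(h ^^ r y) y = (h ^^ r x) ((h ^^ (r y - r x)) y)"
        using xy(4) by (metis comp_apply funpow_add le_add_diff_inverse)
      finally have e: "x = (h ^^ (r y - r x)) y" using h by simp
      have "\<not> r x < r y" using e rmin[of "r y - r x" y] xy(1) r[OF xy(1)] by auto
      then show ?thesis using e by simp
    qed
    show ?thesis
    proof (rule inj_onI)
      fix x y assume "x \<in> B" "y \<in> B" "T x = T y"
      then show "x = y" using *[of x y] *[of y x] by (cases "r x \<le> r y") auto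
    qed
  qed
  have TB: "T ` B \<subseteq> B" using r by (auto simp: T_def)
  have im: "T ` B = B"
    by (rule elementary_eqI)
      (use pT UB B TB inj in \<open>auto simp: elementary_image measure_image\<close>)
  have "exchange T" unfolding exchange_def
  proof (intro conjI allI impI)
    have "bij_betw T (B \<union> - B) (B \<union> - B)"
    proof (rule bij_betw_combine)
      show "bij_betw T B B" using inj im by (simp add: bij_betw_def)
      show "bij_betw T (- B) (- B)" by (rule bij_betwI[where g = T]) (auto simp: T_def)
    qed simp
    then show "bij T" by (simp only: Compl_partition)
    show "T x = x" if "x \<notin> {0..<1}" for x using that B(2) by (auto simp: T_def)
    have "pw_trans T ({0..<1} - B)"
      by (rule pw_trans_cong[of "\<lambda>x. x"]) (use B in \<open>auto simp: pw_trans_Diff T_def\<close>)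
    then have "pw_trans T (B \<union> ({0..<1} - B))" using pT UB by (intro pw_trans_Un) auto
    moreover have "B \<union> ({0..<1} - B) = {0..<1}" using B(2) by auto
    ultimately show "pw_trans T {0..<1}" by simp
  qed
  moreover have "moved T \<subseteq> B" by (auto simp: moved_def T_def)
  ultimately show ?thesis
    using r by (intro that[of T r] rR rmin) (auto simp: T_def)
qed

lemma funpow_fixed: "f x = x \<Longrightarrow> (f ^^ n) x = x"
  by (induction n) auto

lemma funpow_fixed_dvd: "(f ^^ p) x = x \<Longrightarrow> p dvd q \<Longrightarrow> (f ^^ q) x = x"
  by (elim dvdE) (simp add: funpow_mult[symmetric] funpow_fixed)

text \<open>Rokhlin's lemma in the following form: cutting the orbits of \<open>h\<close> at their visits to a small set
  \<open>B\<close> and closing each piece up to a cycle turns \<open>h\<close> into \<open>finv T \<circ> h\<close>, where \<open>T\<close> is the first return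
  map to \<open>B\<close>.\<close>

lemma periodic_approximation:
  assumes h: "exchange h"
  obtains f q where "exchange f" "q > 0" "f ^^ q = id"
    "measure lebesgue (moved (h \<circ> finv f)) \<le> 1 / real (Suc N)"
proof -
  let ?I = "{0..<1::real}"
  \<comment> \<open>Points of period at most \<open>N\<close> lie on short cycles already and keep
    them. The rest is invariant under \<open>h\<close> and has no such period, as the choice of a
    marker set requires.\<close>
  define X where "X = (\<Union>p\<in>{1..N}. {x \<in> ?I. (h ^^ p) x = x})"
  define Y where "Y = ?I - X"
  have hx: "(h ^^ i) x \<in> ?I \<longleftrightarrow> x \<in> ?I" for i x by (rule exchange_mem) (simp add: h)
  have comm: "(h ^^ p) ((h ^^ i) x) = (h ^^ i) ((h ^^ p) x)" for p i x
    by (metis comp_apply funpow_add add.commute)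
  have Xh: "(h ^^ i) x \<in> X \<longleftrightarrow> x \<in> X" for i x
  proof -
    have memX: "y \<in> X \<longleftrightarrow> y \<in> ?I \<and> (\<exists>p\<in>{1..N}. (h ^^ p) y = y)" for y by (auto simp: X_def)
    have "(h ^^ p) ((h ^^ i) x) = (h ^^ i) x \<longleftrightarrow> (h ^^ p) x = x" for p
      unfolding comm using h by simp
    then show ?thesis unfolding memX hx by blast
  qed
  have Yh: "(h ^^ i) x \<in> Y \<longleftrightarrow> x \<in> Y" for i x by (simp only: Y_def Diff_iff hx Xh)
  have "elementary X" unfolding X_def
  proof (intro pw_trans_UN)
    fix p
    have "elementary {x \<in> ?I. (h ^^ p) x - x = 0}"
      by (rule elementary_displacement) (use exchange_funpow[OF h] in \<open>simp add: exchange_def\<close>)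
    then show "elementary {x \<in> ?I. (h ^^ p) x = x}" by simp
  qed simp
  then have Y: "elementary Y" "Y \<subseteq> ?I" by (auto simp: Y_def pw_trans_Diff)
  have np: "(h ^^ p) x \<noteq> x" if "x \<in> Y" "p \<in> {1..N}" for x p
    using that by (auto simp: Y_def X_def)
  obtain B where B: "elementary B" "B \<subseteq> Y" "\<And>p. p \<in> {1..N} \<Longrightarrow> (h ^^ p) ` B \<inter> B = {}"
    and cov: "\<And>x. x \<in> Y \<Longrightarrow> \<exists>i\<le>N. (h ^^ i) x \<in> B \<or> x \<in> (h ^^ i) ` B"
    using marker_set[OF h Y np] by blast
  have B01: "B \<subseteq> ?I" using B(2) Y(2) by auto
  \<comment> \<open>The covering condition looks both ways along the orbit. Applied at the point
    \<open>N\<close> steps before \<open>x\<close>, it puts a visit to \<open>B\<close> at or before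
    \<open>x\<close> in either case.\<close>
  have past: "\<exists>i b. b \<in> B \<and> x = (h ^^ i) b" if x: "x \<in> Y" for x
  proof -
    define z where "z = finv (h ^^ N) x"
    have xz: "x = (h ^^ N) z" using h by (simp add: z_def)
    then have "z \<in> Y" using x Yh by blast
    then obtain i where i: "i \<le> N" "(h ^^ i) z \<in> B \<or> z \<in> (h ^^ i) ` B" using cov by blast
    from i(2) show ?thesis
    proof
      assume "(h ^^ i) z \<in> B"
      moreover have "x = (h ^^ (N - i)) ((h ^^ i) z)"
        using xz i(1) by (metis comp_apply funpow_add le_add_diff_inverse2)
      ultimately show ?thesis by blast
    next
      assume "z \<in> (h ^^ i) ` B"
      then obtain b where "b \<in> B" "z = (h ^^ i) b" by blast
      moreover have "x = (h ^^ (N + i)) b" using xz calculation by (simp add: funpow_add)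
      ultimately show ?thesis by blast
    qed
  qed
  \<comment> \<open>Starting \<open>N + 1\<close> steps after \<open>b\<close> makes both
    alternatives return at a positive time: \<open>N + 1 + i\<close> or \<open>N + 1 - i\<close>
    with \<open>i \<le> N\<close>, hence the bound \<open>2 * N + 1\<close>.\<close>
  have ret: "\<exists>r\<in>{1..2 * N + 1}. (h ^^ r) b \<in> B" if b: "b \<in> B" for b
  proof -
    define z where "z = (h ^^ Suc N) b"
    have "z \<in> Y" using b B(2) Yh unfolding z_def by blast
    then obtain i where i: "i \<le> N" "(h ^^ i) z \<in> B \<or> z \<in> (h ^^ i) ` B" using cov by blast
    from i(2) show ?thesis
    proof
      assume "(h ^^ i) z \<in> B"
      then have "(h ^^ (i + Suc N)) b \<in> B" by (simp only: z_def funpow_add comp_apply)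
      then show ?thesis using i(1) by (intro bexI[of _ "i + Suc N"]) auto
    next
      assume "z \<in> (h ^^ i) ` B"
      then obtain b' where b': "b' \<in> B" "z = (h ^^ i) b'" by blast
      have "z = (h ^^ (i + (Suc N - i))) b" using i(1) by (simp add: z_def)
      then have "z = (h ^^ i) ((h ^^ (Suc N - i)) b)" by (simp only: funpow_add comp_apply)
      then have "b' = (h ^^ (Suc N - i)) b" using b'(2) h by simp
      then show ?thesis using b' i(1) by (intro bexI[of _ "Suc N - i"]) auto
    qed
  qed
  obtain T r where T: "exchange T" "moved T \<subseteq> B" "\<And>b. b \<in> B \<Longrightarrow> r b \<in> {1..2 * N + 1}"
    "\<And>b. b \<in> B \<Longrightarrow> T b = (h ^^ r b) b" "\<And>b. b \<in> B \<Longrightarrow> T b \<in> B"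
    "\<And>b i. b \<in> B \<Longrightarrow> 0 < i \<Longrightarrow> i < r b \<Longrightarrow> (h ^^ i) b \<notin> B"
    using first_return[OF h B(1) B01 ret] by blast
  define f where "f = finv T \<circ> h"
  have f: "exchange f" using h T by (simp add: f_def)
  have fh: "f x = h x" if "h x \<notin> B" for x
  proof -
    have "T (h x) = h x" using that T(2) by (auto simp: moved_def)
    then show ?thesis using T(1) unfolding f_def by (metis comp_apply exchange_inv_f)
  qed
  have fX: "(f ^^ i) x = (h ^^ i) x" if "x \<in> X" for x i
  proof (induction i)
    case (Suc i)
    have "h ((h ^^ i) x) \<in> X" using Xh[of "Suc i" x] that by simp
    then have "h ((h ^^ i) x) \<notin> B" using B(2) by (auto simp: Y_def)
    then show ?case using Suc fh by simp
  qed simp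
  have fB: "(f ^^ i) b = (h ^^ i) b" if "b \<in> B" "i < r b" for b i
    using that(2)
  proof (induction i)
    case (Suc i)
    have "h ((h ^^ i) b) \<notin> B" using T(6)[OF that(1), of "Suc i"] Suc.prems by simp
    then show ?case using Suc fh by simp
  qed simp
  have fr: "(f ^^ r b) b = b" if b: "b \<in> B" for b
  proof -
    obtain k where k: "r b = Suc k" using T(3)[OF b] by (cases "r b") auto
    have "(f ^^ r b) b = f ((h ^^ k) b)" using k fB[OF b, of k] by simp
    also have "\<dots> = finv T ((h ^^ r b) b)" using k by (simp add: f_def)
    also have "\<dots> = b" using T(4)[OF b] T(1) by (metis exchange_inv_f)
    finally show ?thesis .
  qed
  have cycle: "\<exists>p\<in>{1..2 * N + 1}. (f ^^ p) x = x" if x: "x \<in> ?I" for x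
  proof (cases "x \<in> X")
    case True
    then obtain p where p: "p \<in> {1..N}" "(h ^^ p) x = x" by (auto simp: X_def)
    then show ?thesis using fX[OF True] by (intro bexI[of _ p]) auto
  next
    case False
    then have ex: "\<exists>i b. b \<in> B \<and> x = (h ^^ i) b" using x past by (simp add: Y_def)
    \<comment> \<open>The least exponent belongs to the last visit to \<open>B\<close>. If it
      reached \<open>r b\<close>, counting from \<open>T b\<close> instead would give a smaller
      one.\<close>
    define i where "i = (LEAST i. \<exists>b. b \<in> B \<and> x = (h ^^ i) b)"
    have "\<exists>b. b \<in> B \<and> x = (h ^^ i) b" unfolding i_def by (rule LeastI_ex[OF ex])
    then obtain b where b: "b \<in> B" "x = (h ^^ i) b" by blast
    have "i < r b"
    proof (rule ccontr)
      assume "\<not> i < r b"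
      then have "x = (h ^^ (i - r b)) (T b)"
        using b T(4)[OF b(1)] by (metis comp_apply funpow_add le_add_diff_inverse2 not_less)
      then have "i \<le> i - r b" unfolding i_def using T(5)[OF b(1)]
        by (intro Least_le) (auto simp: i_def)
      then show False using T(3)[OF b(1)] \<open>\<not> i < r b\<close> by auto
    qed
    then have "x = (f ^^ i) b" using fB b by simp
    then have "(f ^^ r b) x = x"
      using fr[OF b(1)] by (metis comp_apply funpow_add add.commute)
    then show ?thesis using T(3)[OF b(1)] by blast
  qed
  \<comment> \<open>Every point has some period at most \<open>2 * N + 1\<close>, and the factorial
    is a common multiple of all of these.\<close>
  have per: "f ^^ fact (2 * N + 1) = id"
  proof
    fix x
    show "(f ^^ fact (2 * N + 1)) x = id x"
    proof (cases "x \<in> ?I")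
      case True
      then obtain p where "p \<in> {1..2 * N + 1}" "(f ^^ p) x = x" using cycle by blast
      then show ?thesis using funpow_fixed_dvd[of p f x] dvd_fact[of p "2 * N + 1"] by simp
    next
      case False
      then show ?thesis using exchange_outside[OF exchange_funpow[OF f]] by simp
    qed
  qed
  have hf: "h \<circ> finv f = T"
  proof
    fix x
    have "h (finv f x) = T (f (finv f x))" using T(1) unfolding f_def by simp
    then show "(h \<circ> finv f) x = T x" using f by simp
  qed
  \<comment> \<open>\<open>B\<close> and its first \<open>N\<close> iterates are
    \<open>N + 1\<close> disjoint sets of equal measure in the unit interval. Since the error is
    \<open>T\<close>, which moves only points of \<open>B\<close>, this bounds its support.\<close>
  have "real (Suc N) * measure lebesgue B \<le> 1"
  proof -
    have "elementary (\<Union>i\<le>N. (h ^^ i) ` B)"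
      by (intro pw_trans_UN exchange_elementary_image exchange_funpow h B B01) simp
    moreover have "(\<Union>i\<le>N. (h ^^ i) ` B) \<subseteq> ?I" using B01 hx by blast
    ultimately show ?thesis
      using measure_UN_images[OF h B(1) B01 B(3), of N] measure_le_1 by metis
  qed
  moreover have "measure lebesgue (moved T) \<le> measure lebesgue B"
    using T B by (intro lebesgue_mono) (auto simp: elementary_moved)
  ultimately have "measure lebesgue (moved (h \<circ> finv f)) \<le> 1 / real (Suc N)"
    unfolding hf by (simp add: field_simps del: of_nat_Suc) (smt (verit) mult_left_mono of_nat_0_le_iff mult.commute)
  then show ?thesis using that[OF f _ per] by simp
qed

section \<open>Products of involutions\<close>

text \<open>With \<open>A\<close> the set of minima of the orbits of \<open>f\<close>, the involution \<open>v\<close> maps \<open>f\<^sup>k a\<close> to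
  \<open>f\<^sup>-\<^sup>k a\<close> for \<open>a \<in> A\<close>.\<close>

lemma periodic_two_involutions:
  assumes f: "exchange f" and q: "q > 0" "f ^^ q = id"
  obtains u v where "exchange u" "exchange v" "u \<circ> u = id" "v \<circ> v = id" "f = u \<circ> v"
proof -
  let ?I = "{0..<1::real}"
  have fI: "(f ^^ k) x \<in> ?I \<longleftrightarrow> x \<in> ?I" for k x by (rule exchange_mem) (simp add: f)
  have add: "(f ^^ k) ((f ^^ l) x) = (f ^^ (k + l)) x" for k l x by (simp add: funpow_add)
  have fq: "(f ^^ (q * n)) x = x" for n x
    by (rule funpow_fixed_dvd[of q]) (simp_all add: q)
  have fm: "(f ^^ (n mod q)) x = (f ^^ n) x" for n x
  proof -
    have "(f ^^ n) x = (f ^^ (n mod q)) ((f ^^ (q * (n div q))) x)" by (simp add: add)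
    then show ?thesis by (simp add: fq)
  qed
  \<comment> \<open>Being least in the orbit is a sign condition on the displacements of finitely
    many powers of \<open>f\<close>, so \<open>A\<close> is elementary.\<close>
  define A where "A = ?I - (\<Union>k<q. {x \<in> ?I. (f ^^ k) x - x < 0})"
  have "elementary {x \<in> ?I. (f ^^ k) x - x < 0}" for k
    by (rule elementary_displacement) (use exchange_funpow[OF f] in \<open>simp add: exchange_def\<close>)
  then have "elementary A"
    unfolding A_def by (intro pw_trans_Diff pw_trans_UN) auto
  then have A: "elementary A" "A \<subseteq> ?I" by (auto simp: A_def)
  have memA: "x \<in> A \<longleftrightarrow> x \<in> ?I \<and> (\<forall>k<q. x \<le> (f ^^ k) x)" for x
    by (auto simp: A_def not_less)
  have Amin: "a \<le> (f ^^ n) a" if "a \<in> A" for a n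
  proof -
    have "n mod q < q" using q(1) by simp
    then have "a \<le> (f ^^ (n mod q)) a" using that memA by blast
    then show ?thesis by (simp add: fm)
  qed
  have orbit: "\<exists>k a. k \<le> q \<and> a \<in> A \<and> x = (f ^^ k) a" if x: "x \<in> ?I" for x
  proof -
    let ?O = "(\<lambda>k. (f ^^ k) x) ` {..<q}"
    have O: "finite ?O" "?O \<noteq> {}" using q by auto
    from Min_in[OF O] obtain k where k': "Min ?O = (f ^^ k) x" "k \<in> {..<q}" by (rule imageE)
    then have k: "k < q" "(f ^^ k) x \<le> y" if "y \<in> ?O" for y using O(1) Min_le[OF O(1) that] by simp_all
    have "(f ^^ k) x \<le> (f ^^ l) ((f ^^ k) x)" for l
    proof -
      have "(f ^^ ((l + k) mod q)) x \<in> ?O" using q by auto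
      from k(2)[OF this] show ?thesis by (simp add: fm add)
    qed
    then have "(f ^^ k) x \<in> A" using x fI[of k x] memA by blast
    moreover have "x = (f ^^ (q - k)) ((f ^^ k) x)" using k' fq[of 1] by (simp add: add)
    ultimately show ?thesis by (intro exI[of _ "q - k"] exI[of _ "(f ^^ k) x"]) simp
  qed
  \<comment> \<open>This makes \<open>v\<close> well defined. Two minima on one orbit coincide, but
    the exponents \<open>k\<close> and \<open>l\<close> may still differ by a multiple of the period
    of the orbit.\<close>
  have uniq: "(f ^^ (q - k)) a = (f ^^ (q - l)) b"
    if ab: "a \<in> A" "b \<in> A" "k \<le> q" "l \<le> q" "(f ^^ k) a = (f ^^ l) b" for a b k l
  proof -
    have "(f ^^ (q - k)) ((f ^^ k) a) = (f ^^ (q - k)) ((f ^^ l) b)"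
      "(f ^^ (q - l)) ((f ^^ l) b) = (f ^^ (q - l)) ((f ^^ k) a)" using ab(5) by simp_all
    then have "a = (f ^^ (q - k + l)) b" "b = (f ^^ (q - l + k)) a"
      using ab(3,4) fq[of 1] by (simp_all add: add)
    then have "a = b" using Amin[OF ab(1)] Amin[OF ab(2)] by (metis order_antisym)
    have c: "(f ^^ (q - k)) ((f ^^ k) a) = a" "(f ^^ (q - l)) ((f ^^ l) b) = b"
      using ab(3,4) fq[of 1] by (simp_all add: add)
    have "(f ^^ (q - k)) a = (f ^^ (q - k)) ((f ^^ (q - l)) ((f ^^ k) a))"
      unfolding ab(5) c(2) by (simp add: \<open>a = b\<close>)
    also have "\<dots> = (f ^^ (q - l)) ((f ^^ (q - k)) ((f ^^ k) a))"
      by (simp only: add add.left_commute)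
    also have "\<dots> = (f ^^ (q - l)) b" unfolding c(1) by (simp only: \<open>a = b\<close>)
    finally show ?thesis .
  qed
  define P where "P x p \<longleftrightarrow> fst p \<le> q \<and> snd p \<in> A \<and> x = (f ^^ fst p) (snd p)" for x p
  \<comment> \<open>As \<open>f ^^ q\<close> is the identity, \<open>q - k\<close> serves as the
    exponent \<open>- k\<close>. By \<open>uniq\<close> the value does not depend on the
    representation that \<open>SOME\<close> picks.\<close>
  define v where "v x = (if x \<in> ?I then let p = SOME p. P x p in (f ^^ (q - fst p)) (snd p) else x)" for x
  have v: "v ((f ^^ k) a) = (f ^^ (q - k)) a" if "a \<in> A" "k \<le> q" for k a
  proof -
    have "P ((f ^^ k) a) (k, a)" using that by (simp add: P_def)
    then have "P ((f ^^ k) a) (SOME p. P ((f ^^ k) a) p)" by (rule someI)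
    moreover define p where "p = (SOME p. P ((f ^^ k) a) p)"
    ultimately have p: "fst p \<le> q" "snd p \<in> A" "(f ^^ k) a = (f ^^ fst p) (snd p)"
      by (simp_all only: P_def)
    have "(f ^^ k) a \<in> ?I" using that A(2) fI by blast
    then have "v ((f ^^ k) a) = (f ^^ (q - fst p)) (snd p)"
      by (simp only: v_def if_True Let_def p_def)
    also have "\<dots> = (f ^^ (q - k)) a" by (rule uniq[OF that(1) p(2) that(2) p(1,3), symmetric])
    finally show ?thesis .
  qed
  have vout: "v x = x" if "x \<notin> ?I" for x using that by (simp only: v_def if_False)
  have vv: "v \<circ> v = id"
  proof
    fix x
    show "(v \<circ> v) x = id x"
    proof (cases "x \<in> ?I")
      case True
      then obtain k a where "k \<le> q" "a \<in> A" "x = (f ^^ k) a" using orbit by blast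
      then show ?thesis by (simp add: v)
    next
      case False
      then show ?thesis using vout[OF False] by (simp only: comp_apply id_apply)
    qed
  qed
  \<comment> \<open>On each cycle \<open>f\<close> is a rotation and \<open>v\<close> a reflection,
    so \<open>f \<circ> v\<close> is a reflection too; it becomes \<open>u\<close>.\<close>
  have fv: "f (v (f (v x))) = x" for x
  proof (cases "x \<in> ?I")
    case True
    then obtain k a where k: "k \<le> q" "a \<in> A" "x = (f ^^ k) a" using orbit by blast
    show ?thesis
    proof (cases k)
      case 0
      have "f ((f ^^ q) a) = (f ^^ 1) a" using fq[of 1] by simp
      moreover have "f ((f ^^ (q - 1)) a) = a" using q fq[of 1] add[of 1 "q - 1" a] by simp
      moreover have "v ((f ^^ 1) a) = (f ^^ (q - 1)) a" by (rule v) (use k q in auto)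
      ultimately show ?thesis using k 0 v[of a 0] by simp
    next
      case (Suc j)
      have "f ((f ^^ (q - k)) a) = (f ^^ (q - j)) a"
        using k(1) Suc add[of 1 "q - k" a] by (simp add: Suc_diff_Suc)
      moreover have "v ((f ^^ (q - j)) a) = (f ^^ j) a" using v[of a "q - j"] k Suc by simp
      ultimately show ?thesis using k Suc v[of a k] by simp
    qed
  next
    case False
    then show ?thesis using exchange_outside[OF f False] vout[OF False] by simp
  qed
  have "exchange v"
  proof (rule exchange_involution)
    have "pw_trans v ((f ^^ k) ` A)" if "k \<le> q" for k
    proof (rule pw_trans_cong)
      \<comment> \<open>On the \<open>k\<close>-th image of \<open>A\<close> the map
        \<open>v\<close> is one fixed power of \<open>f\<close>: adding \<open>2 * (q - k)\<close>
        to the exponent \<open>k\<close> gives \<open>q - k\<close> modulo \<open>q\<close>.\<close>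
      show "pw_trans (f ^^ ((q - k) + (q - k))) ((f ^^ k) ` A)"
        using exchange_funpow[OF f] A
        by (metis exchange_pw_trans exchange_elementary_image exchange_image_subset)
      fix x assume "x \<in> (f ^^ k) ` A"
      then obtain a where a: "a \<in> A" "x = (f ^^ k) a" by blast
      have "(f ^^ ((q - k) + (q - k))) x = (f ^^ (q - k)) ((f ^^ (q - k + k)) a)"
        by (simp only: a add[symmetric])
      also have "\<dots> = (f ^^ (q - k)) a" using that fq[of 1] by simp
      finally show "(f ^^ ((q - k) + (q - k))) x = v x" using v[OF a(1) that] a by simp
    qed
    then have "pw_trans v (\<Union>k\<in>{..q}. (f ^^ k) ` A)" by (intro pw_trans_UN) auto
    moreover have "(\<Union>k\<in>{..q}. (f ^^ k) ` A) = ?I"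
    proof (intro equalityI subsetI)
      fix x assume "x \<in> ?I"
      then obtain k a where "k \<le> q" "a \<in> A" "x = (f ^^ k) a" using orbit by blast
      then show "x \<in> (\<Union>k\<in>{..q}. (f ^^ k) ` A)" by blast
    qed (use A(2) fI in blast)
    ultimately show "pw_trans v ?I" by simp
  qed (use vout vv in auto)
  moreover have "f = (f \<circ> v) \<circ> v" using vv by (simp add: o_assoc[symmetric])
  moreover have "(f \<circ> v) \<circ> (f \<circ> v) = id" using fv by auto
  ultimately show ?thesis using that[of "f \<circ> v" v] f vv by simp
qed

section \<open>Products of conjugated commutators in an arbitrary group\<close>

definition comm_conj :: "('a, 'b) monoid_scheme \<Rightarrow> 'a \<Rightarrow> 'a \<times> 'a \<Rightarrow> 'a" where
  "comm_conj G g p = fst p \<otimes>\<^bsub>G\<^esub> (g \<otimes>\<^bsub>G\<^esub> snd p \<otimes>\<^bsub>G\<^esub> inv\<^bsub>G\<^esub> g \<otimes>\<^bsub>G\<^esub> inv\<^bsub>G\<^esub> (snd p)) \<otimes>\<^bsub>G\<^esub> inv\<^bsub>G\<^esub> (fst p)"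

text \<open>A word in \<open>g\<close> whose parameters, pairs \<open>(w, s)\<close> standing for
  \<open>w [g, s] w\<inverse>\<close>, are kept as a list. This allows the same word to be evaluated
  in different groups and its length to be controlled.\<close>

definition comm_conj_prod :: "('a, 'b) monoid_scheme \<Rightarrow> 'a \<Rightarrow> ('a \<times> 'a) list \<Rightarrow> 'a" where
  "comm_conj_prod G g ps = foldr (\<lambda>p. (\<otimes>\<^bsub>G\<^esub>) (comm_conj G g p)) ps \<one>\<^bsub>G\<^esub>"

lemma comm_conj_prod_simps [simp]:
  "comm_conj_prod G g [] = \<one>\<^bsub>G\<^esub>"
  "comm_conj_prod G g (p # ps) = comm_conj G g p \<otimes>\<^bsub>G\<^esub> comm_conj_prod G g ps"
  by (simp_all add: comm_conj_prod_def)

lemma (in group) comm_conj_closed: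
  "g \<in> carrier G \<Longrightarrow> p \<in> carrier G \<times> carrier G \<Longrightarrow> comm_conj G g p \<in> carrier G"
  by (auto simp: comm_conj_def)

lemma (in group) comm_conj_prod_closed:
  "g \<in> carrier G \<Longrightarrow> set ps \<subseteq> carrier G \<times> carrier G \<Longrightarrow> comm_conj_prod G g ps \<in> carrier G"
  by (induction ps) (auto intro!: comm_conj_closed)

lemma (in group) comm_conj_prod_append:
  "g \<in> carrier G \<Longrightarrow> set ps \<subseteq> carrier G \<times> carrier G \<Longrightarrow> set qs \<subseteq> carrier G \<times> carrier G \<Longrightarrow>
    comm_conj_prod G g (ps @ qs) = comm_conj_prod G g ps \<otimes> comm_conj_prod G g qs"
  by (induction ps) (auto simp: comm_conj_closed comm_conj_prod_closed m_assoc)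

text \<open>Used for three homomorphisms: restriction to \<open>[0,1]\<close>, evaluation of a
  sequence at a coordinate, and the quotient map onto the ultrapower.\<close>

lemma (in group_hom) comm_conj_prod_hom:
  "g \<in> carrier G \<Longrightarrow> set ps \<subseteq> carrier G \<times> carrier G \<Longrightarrow>
    h (comm_conj_prod G g ps) = comm_conj_prod H (h g) (map (map_prod h h) ps)"
proof (induction ps)
  case (Cons p ps)
  then have "h (comm_conj G g p) = comm_conj H (h g) (map_prod h h p)"
    by (auto simp: comm_conj_def)
  then show ?case using Cons G.comm_conj_closed[of g p] G.comm_conj_prod_closed[of g ps] by auto
qed simp

text \<open>Each factor \<open>w [g, s] w\<inverse>\<close> is the product of the conjugates of \<open>g\<close> by \<open>w\<close> and of \<open>g\<inverse>\<close> by
  \<open>w s\<close>.\<close>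

lemma (in group) comm_conj_prod_conjugates:
  assumes "g \<in> carrier G" "set ps \<subseteq> carrier G \<times> carrier G"
  shows "\<exists>cs. length cs = 2 * length ps \<and> set cs \<subseteq> conjugates_pm G g \<and>
    comm_conj_prod G g ps = foldr (\<otimes>) cs \<one>"
  using assms(2)
proof (induction ps)
  case (Cons p ps)
  then obtain cs where cs: "length cs = 2 * length ps" "set cs \<subseteq> conjugates_pm G g"
    "comm_conj_prod G g ps = foldr (\<otimes>) cs \<one>" by auto
  obtain w s where p: "p = (w, s)" "w \<in> carrier G" "s \<in> carrier G" using Cons.prems by auto
  let ?a = "w \<otimes> g \<otimes> inv w" and ?b = "(w \<otimes> s) \<otimes> inv g \<otimes> inv (w \<otimes> s)"
  have "?a \<in> conjugates_pm G g" "?b \<in> conjugates_pm G g"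
    unfolding conjugates_pm_def using p by blast+
  moreover have "comm_conj G g p \<otimes> X = ?a \<otimes> (?b \<otimes> X)" if "X \<in> carrier G" for X
  proof -
    have "?a \<otimes> (?b \<otimes> X) = w \<otimes> g \<otimes> (inv w \<otimes> w) \<otimes> s \<otimes> inv g \<otimes> inv s \<otimes> inv w \<otimes> X"
    proof -
      have "inv w \<otimes> (w \<otimes> Y) = Y" if "Y \<in> carrier G" for Y
        using that p(2) by (simp add: m_assoc[symmetric])
      then show ?thesis using p that assms(1) by (simp add: m_assoc inv_mult_group)
    qed
    also have "\<dots> = comm_conj G g p \<otimes> X"
      using p that assms(1) by (simp add: comm_conj_def m_assoc)
    finally show ?thesis by simp
  qed
  moreover have "comm_conj_prod G g ps \<in> carrier G"
    using comm_conj_prod_closed assms(1) Cons.prems by simp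
  ultimately show ?case using cs by (intro exI[of _ "?a # ?b # cs"]) simp
qed simp

section \<open>Approximation by a bounded number of conjugated commutators\<close>

definition exchange_group :: "(real \<Rightarrow> real) monoid" where
  "exchange_group = \<lparr>carrier = {f. exchange f}, mult = (\<circ>), one = id\<rparr>"

lemma exchange_group_simps [simp]:
  "carrier exchange_group = {f. exchange f}" "mult exchange_group = (\<circ>)" "one exchange_group = id"
  by (simp_all add: exchange_group_def)

lemma group_exchange_group: "group exchange_group"
proof (rule groupI)
  fix f assume "f \<in> carrier exchange_group"
  then show "\<exists>g\<in>carrier exchange_group. g \<otimes>\<^bsub>exchange_group\<^esub> f = \<one>\<^bsub>exchange_group\<^esub>"
    by (intro bexI[of _ "finv f"]) (auto simp: fun_eq_iff)
qed (auto simp: o_assoc)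

interpretation EG: group exchange_group by (rule group_exchange_group)

lemma exchange_group_inv [simp]: "exchange f \<Longrightarrow> inv\<^bsub>exchange_group\<^esub> f = finv f"
  by (rule EG.inv_equality) (auto simp: fun_eq_iff)

text \<open>Every point is fixed by one of the two maps, so they commute. With \<open>s'\<close> the
  conjugate of \<open>s\<close> by \<open>g\<close>, the composite \<open>s' \<circ> s\<close> is
  the commutator of \<open>g\<close> and \<open>s\<close>.\<close>

lemma disjoint_involutions:
  assumes s: "s \<circ> s = id" "s' \<circ> s' = id" and d: "moved s \<inter> moved s' = {}"
  shows "(s' \<circ> s) \<circ> (s' \<circ> s) = id" "moved (s' \<circ> s) = moved s \<union> moved s'"
proof -
  have ss: "s (s x) = x" "s' (s' x) = x" for x using s by (metis comp_apply id_apply)+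
  have d': "s x = x \<or> s' x = x" for x using d by (auto simp: moved_def)
  have c: "s' (s x) = s (s' x)" for x using ss d' by metis
  show "(s' \<circ> s) \<circ> (s' \<circ> s) = id" using c ss by (auto simp: fun_eq_iff)
  show "moved (s' \<circ> s) = moved s \<union> moved s'"
    unfolding moved_def using ss d' by (auto; metis)
qed

text \<open>An \<open>s\<close> inside \<open>B\<close> moving half as much as \<open>t\<close>
  suffices, because its commutator with \<open>g\<close> moves twice as much as \<open>s\<close>;
  hence the bound by twice the measure of \<open>B\<close>.\<close>

lemma small_involution_comm_conj:
  assumes g: "exchange g" and B: "elementary B" "B \<subseteq> {0..<1}" "g ` B \<inter> B = {}"
    and t: "exchange t" "t \<circ> t = id" "measure lebesgue (moved t) \<le> 2 * measure lebesgue B"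
  obtains p where "p \<in> carrier exchange_group \<times> carrier exchange_group" "t = comm_conj exchange_group g p"
proof -
  obtain s where s: "exchange s" "s \<circ> s = id" "moved s \<subseteq> B"
    "measure lebesgue (moved s) = measure lebesgue (moved t) / 2"
    using involution_exists[OF B(1,2), of "measure lebesgue (moved t) / 2"] t(3) by auto
  let ?s = "g \<circ> s \<circ> finv g"
  have s': "exchange ?s" "?s \<circ> ?s = id" using g s(1,2) by (auto simp: fun_eq_iff)
  have ms': "moved ?s = g ` moved s" using moved_conj[OF g] .
  have d: "moved s \<inter> moved ?s = {}" using ms' s(3) B(3) by blast
  note c = disjoint_involutions[OF s(2) s'(2) d]
  have "measure lebesgue (moved (?s \<circ> s)) = measure lebesgue (moved t)"
    unfolding c(2)
    using lebesgue_Un_disjoint[OF elementary_moved[OF s(1)] elementary_moved[OF s'(1)] d] s(4)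
      exchange_measure_image[OF g elementary_moved[OF s(1)] moved_subset[OF s(1)]] ms' by simp
  then obtain w where w: "exchange w" "t = w \<circ> (?s \<circ> s) \<circ> finv w"
    using involution_conjugate[OF _ c(1) t(1,2)] s(1) s'(1) by auto
  have "finv s = s" using s(2) by (metis inv_unique_comp)
  then have "t = comm_conj exchange_group g (w, s)"
    using w s(1) g by (simp add: comm_conj_def o_assoc)
  then show ?thesis using that[of "(w, s)"] w s by simp
qed

text \<open>Each step splits off the restriction of \<open>t\<close> to an invariant set of measure
  up to twice that of \<open>B\<close>. The length is exactly \<open>M\<close>: once
  \<open>t\<close> is used up, the remaining factors represent the identity.\<close>

lemma involution_comm_conj_prod:
  assumes g: "exchange g" and B: "elementary B" "B \<subseteq> {0..<1}" "g ` B \<inter> B = {}"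
  shows "exchange t \<Longrightarrow> t \<circ> t = id \<Longrightarrow> measure lebesgue (moved t) \<le> real M * (2 * measure lebesgue B) \<Longrightarrow>
    \<exists>ps. length ps = M \<and> set ps \<subseteq> carrier exchange_group \<times> carrier exchange_group \<and>
      t = comm_conj_prod exchange_group g ps"
proof (induction M arbitrary: t)
  case 0
  then have "moved t = {}"
    using measure_nonneg[of lebesgue "moved t"] by (intro elementary_null_empty elementary_moved) auto
  then have "t = id" by (auto simp: moved_def)
  then show ?case by (intro exI[of _ "[]"]) (simp add: id_def)
next
  case (Suc M)
  note t = Suc.prems
  have tt: "t (t x) = x" for x using t(2) by (metis comp_apply id_apply)
  obtain A where A: "elementary A" "A \<subseteq> {0..<1}" "elementary (t ` A)" "A \<inter> t ` A = {}"
    "moved t = A \<union> t ` A" "measure lebesgue (moved t) = 2 * measure lebesgue A"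
    using involution_halves[OF t(1,2)] .
  obtain A1 where A1: "elementary A1" "A1 \<subseteq> A"
    "measure lebesgue A1 = min (measure lebesgue A) (measure lebesgue B)"
    using elementary_subset_of_measure[OF A(1), of "min (measure lebesgue A) (measure lebesgue B)"] by auto
  have A1I: "A1 \<subseteq> {0..<1}" using A A1 by auto
  let ?S = "A1 \<union> t ` A1"
  let ?R = "{0..<1} - ?S"
  have eA1: "elementary (t ` A1)" using exchange_elementary_image[OF t(1) A1(1) A1I] .
  have eS: "elementary ?S" by (rule pw_trans_Un[OF A1(1) eA1])
  have eR: "elementary ?R" using eS by (simp add: pw_trans_Diff)
  have SI: "?S \<subseteq> {0..<1}" using A1I exchange_image_subset[OF t(1) A1I] by auto
  have tS: "t ` ?S = ?S" by (auto simp: image_image image_Un tt)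
  have tR: "t ` ?R = ?R"
    using image_set_diff[OF bij_is_inj[OF exchange_bij[OF t(1)]]] tS exchange_image_unit[OF t(1)] by metis
  have mS: "measure lebesgue ?S = 2 * measure lebesgue A1"
    using lebesgue_Un_disjoint[OF A1(1) eA1] A(4) A1(2) exchange_measure_image[OF t(1) A1(1) A1I] by auto
  define t1 where "t1 = (\<lambda>x. if x \<in> ?S then t x else x)"
  define t2 where "t2 = (\<lambda>x. if x \<in> ?R then t x else x)"
  have t12: "exchange t1" "exchange t2"
    unfolding t1_def t2_def using exchange_restrict[OF t(1) eS SI tS] exchange_restrict[OF t(1) eR _ tR] by auto
  have memS: "t x \<in> ?S \<longleftrightarrow> x \<in> ?S" for x using tS tt by (metis imageI)
  have memR: "t x \<in> ?R \<longleftrightarrow> x \<in> ?R" for x using tR tt by (metis imageI)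
  have i1: "t1 \<circ> t1 = id" unfolding t1_def using memS tt by (auto simp: fun_eq_iff)
  have i2: "t2 \<circ> t2 = id"
  proof
    show "(t2 \<circ> t2) x = id x" for x by (cases "x \<in> ?R") (simp_all only: t2_def comp_apply memR tt if_True if_False id_apply)
  qed
  have mv1: "moved t1 \<subseteq> ?S" by (auto simp: moved_def t1_def)
  have mv2: "moved t2 \<subseteq> moved t - ?S" by (auto simp: moved_def t2_def)
  have "t = t1 \<circ> t2"
  proof
    fix x
    show "t x = (t1 \<circ> t2) x"
    proof (cases "x \<in> ?R")
      case True
      then have "t2 x = t x" by (simp only: t2_def if_True)
      moreover have "t x \<notin> ?S" using True memR[of x] by blast
      ultimately show ?thesis by (simp only: t1_def comp_apply if_False)
    next
      case False
      then have "x \<in> ?S \<or> t x = x" using exchange_outside[OF t(1)] by blast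
      moreover have "t2 x = x" using False by (simp only: t2_def if_False)
      ultimately show ?thesis by (auto simp: t1_def)
    qed
  qed
  have "measure lebesgue (moved t1) \<le> measure lebesgue ?S"
    by (rule lebesgue_mono[OF elementary_moved[OF t12(1)] eS mv1])
  then have "measure lebesgue (moved t1) \<le> 2 * measure lebesgue B" using mS A1(3) by auto
  then obtain p where p: "p \<in> carrier exchange_group \<times> carrier exchange_group"
    "t1 = comm_conj exchange_group g p"
    using small_involution_comm_conj[OF g B t12(1) i1] by blast
  have "?S \<subseteq> moved t" using A(5) A1(2) by auto
  then have "measure lebesgue (moved t2) \<le> measure lebesgue (moved t) - measure lebesgue ?S"
    using lebesgue_mono[OF elementary_moved[OF t12(2)] _ mv2] lebesgue_Diff[OF elementary_moved[OF t(1)] eS]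
      pw_trans_Diff[OF elementary_moved[OF t(1)] eS] by auto
  also have "\<dots> \<le> real M * (2 * measure lebesgue B)"
  proof (cases "measure lebesgue A \<le> measure lebesgue B")
    case True
    then show ?thesis using mS A1(3) A(6) by simp
  next
    case False
    then show ?thesis using mS A1(3) t(3) by (simp add: algebra_simps)
  qed
  finally obtain ps where "length ps = M" "set ps \<subseteq> carrier exchange_group \<times> carrier exchange_group"
    "t2 = comm_conj_prod exchange_group g ps" using Suc.IH[OF t12(2) i2] by blast
  then show ?case using p \<open>t = t1 \<circ> t2\<close> by (intro exI[of _ "p # ps"]) auto
qed

text \<open>What matters is the order of the quantifiers: \<open>M\<close> is fixed before
  \<open>g\<close>, \<open>h\<close> and the precision \<open>n\<close>.\<close>

lemma exchange_approximation:
  assumes "\<epsilon> > 0"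
  obtains M where "\<And>g h n. exchange g \<Longrightarrow> \<epsilon> \<le> measure lebesgue (moved g) \<Longrightarrow> exchange h \<Longrightarrow>
    \<exists>ps. length ps = M \<and> set ps \<subseteq> carrier exchange_group \<times> carrier exchange_group \<and>
      measure lebesgue (moved (h \<circ> finv (comm_conj_prod exchange_group g ps))) \<le> 1 / real (Suc n)"
proof -
  \<comment> \<open>One factor handles twice the measure of \<open>B\<close>, which is at least
    2\<epsilon>/3, and an involution moves at most measure 1. So \<open>K\<close> factors suffice
    for one involution, and \<open>2 * K\<close> for the two whose product approximates
    \<open>h\<close>.\<close>
  define K where "K = nat \<lceil>3 / (2 * \<epsilon>)\<rceil>"
  have K: "3 / (2 * \<epsilon>) \<le> real K" unfolding K_def by linarith
  have "\<exists>ps. length ps = 2 * K \<and> set ps \<subseteq> carrier exchange_group \<times> carrier exchange_group \<and>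
      measure lebesgue (moved (h \<circ> finv (comm_conj_prod exchange_group g ps))) \<le> 1 / real (Suc n)"
    if g: "exchange g" and e: "\<epsilon> \<le> measure lebesgue (moved g)" and h: "exchange h" for g h n
  proof -
    obtain B where B: "elementary B" "B \<subseteq> moved g" "\<And>p. p \<in> {1..1} \<Longrightarrow> (g ^^ p) ` B \<inter> B = {}"
      and cov: "\<And>x. x \<in> moved g \<Longrightarrow> \<exists>i\<le>1. (g ^^ i) x \<in> B \<or> x \<in> (g ^^ i) ` B"
      using marker_set[OF g elementary_moved[OF g] moved_subset[OF g], of 1] by (auto simp: moved_def)
    have BI: "B \<subseteq> {0..<1}" using B(2) moved_subset[OF g] by auto
    have gB: "g ` B \<inter> B = {}" using B(3)[of 1] by simp
    \<comment> \<open>With the parameter 1 of \<open>marker_set\<close>, every moved point is at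
      most one step from \<open>B\<close>. Three sets of equal measure therefore cover the support,
      which is the origin of the 3 in \<epsilon>/3.\<close>
    have "moved g \<subseteq> B \<union> (g ` B \<union> finv g ` B)"
    proof
      fix x assume "x \<in> moved g"
      then obtain i where i: "i \<le> 1" "(g ^^ i) x \<in> B \<or> x \<in> (g ^^ i) ` B" using cov by blast
      have "x \<in> finv g ` B" if "g x \<in> B" using that g by (metis exchange_inv_f imageI)
      then show "x \<in> B \<union> (g ` B \<union> finv g ` B)" using i by (cases i) auto
    qed
    moreover have el: "elementary (g ` B)" "elementary (finv g ` B)"
      using exchange_elementary_image[OF _ B(1) BI] g by auto
    ultimately have "measure lebesgue (moved g) \<le> measure lebesgue (B \<union> (g ` B \<union> finv g ` B))"
      using B(1) by (intro lebesgue_mono elementary_moved pw_trans_Un g)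
    also have "\<dots> \<le> measure lebesgue B + (measure lebesgue (g ` B) + measure lebesgue (finv g ` B))"
      using B(1) el by (intro order_trans[OF measure_Un_le] add_left_mono measure_Un_le)
        (auto simp: fmeasurableD)
    also have "\<dots> = 3 * measure lebesgue B"
      using exchange_measure_image[OF _ B(1) BI] g by simp
    finally have eB: "\<epsilon> \<le> 3 * measure lebesgue B" using e by simp
    have "1 \<le> (3 / (2 * \<epsilon>)) * (2 * (\<epsilon> / 3))" using assms by simp
    also have "\<dots> \<le> real K * (2 * measure lebesgue B)"
      using K eB assms by (intro mult_mono) auto
    finally have big: "1 \<le> real K * (2 * measure lebesgue B)" .
    have inv_prod: "\<exists>ps. length ps = K \<and> set ps \<subseteq> carrier exchange_group \<times> carrier exchange_group \<and>
      t = comm_conj_prod exchange_group g ps" if "exchange t" "t \<circ> t = id" for t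
      using that measure_le_1[OF elementary_moved moved_subset, of t] big
      by (intro involution_comm_conj_prod[OF g B(1) BI gB]) auto
    obtain f q where f: "exchange f" "q > 0" "f ^^ q = id"
      "measure lebesgue (moved (h \<circ> finv f)) \<le> 1 / real (Suc n)"
      using periodic_approximation[OF h] by blast
    obtain u v where uv: "exchange u" "exchange v" "u \<circ> u = id" "v \<circ> v = id" "f = u \<circ> v"
      using periodic_two_involutions[OF f(1-3)] .
    obtain ps qs where ps: "length ps = K" "set ps \<subseteq> carrier exchange_group \<times> carrier exchange_group"
      "u = comm_conj_prod exchange_group g ps" and qs: "length qs = K"
      "set qs \<subseteq> carrier exchange_group \<times> carrier exchange_group" "v = comm_conj_prod exchange_group g qs"
      using inv_prod[OF uv(1,3)] inv_prod[OF uv(2,4)] by blast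
    have "f = comm_conj_prod exchange_group g (ps @ qs)"
      using EG.comm_conj_prod_append[of g ps qs] ps qs uv(5) g by simp
    then show ?thesis using f(4) ps(1,2) qs(1,2) by (intro exI[of _ "ps @ qs"]) simp
  qed
  then show ?thesis using that by blast
qed

section \<open>The group of interval exchange transformations\<close>

text \<open>Only the left end points of the pieces are exceptional, since a half-open interval does
  not contain its right end. This bounds the discontinuities of an exchange.\<close>

lemma pw_trans_local:
  "pw_trans f A \<Longrightarrow> \<exists>D. finite D \<and> (\<forall>x\<in>A - D. \<exists>e>0. \<exists>c. \<forall>y. \<bar>y - x\<bar> < e \<longrightarrow> y \<in> A \<and> f y = y + c)"
proof (induction rule: pw_trans.induct)
  case empty
  show ?case by (intro exI[of _ "{}"]) simp
next
  case (insert A a b c)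
  then obtain D where D: "finite D"
    "\<And>x. x \<in> A - D \<Longrightarrow> \<exists>e>0. \<exists>c. \<forall>y. \<bar>y - x\<bar> < e \<longrightarrow> y \<in> A \<and> f y = y + c" by auto
  have "\<exists>e>0. \<exists>c. \<forall>y. \<bar>y - x\<bar> < e \<longrightarrow> y \<in> A \<union> {a..<b} \<and> f y = y + c"
    if x: "x \<in> A \<union> {a..<b} - insert a D" for x
  proof (cases "x \<in> A")
    case True
    then show ?thesis using D(2)[of x] x by (meson DiffI UnI1 insertI2 DiffD2)
  next
    case False
    then have "a < x" "x < b" using x by auto
    then have "min (x - a) (b - x) > 0"
      and "\<And>y. \<bar>y - x\<bar> < min (x - a) (b - x) \<Longrightarrow> y \<in> {a..<b}" by auto
    then show ?thesis using insert.hyps(2) by (metis UnCI)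
  qed
  moreover have "finite (insert a D)" using D(1) by simp
  ultimately show ?case by blast
qed

lemma pw_trans_right_germ:
  "pw_trans f A \<Longrightarrow> x \<in> A \<Longrightarrow> \<exists>z>x. \<exists>c. \<forall>y\<in>{x..<z}. f y = y + c"
proof (induction rule: pw_trans.induct)
  case (insert A a b c)
  show ?case
  proof (cases "x \<in> A")
    case True
    then show ?thesis using insert.IH by blast
  next
    case False
    then have "x \<in> {a..<b}" using insert.prems by auto
    then show ?thesis using insert.hyps(2) by (intro exI[of _ b] conjI exI[of _ c]) auto
  qed
qed simp

lemma pw_trans_finite_displacements: "pw_trans f A \<Longrightarrow> finite ((\<lambda>x. f x - x) ` A)"
proof (induction rule: pw_trans.induct)
  case (insert A a b c)
  have "(\<lambda>x. f x - x) ` {a..<b} \<subseteq> {c}" using insert.hyps(2) by auto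
  then have "finite ((\<lambda>x. f x - x) ` {a..<b})" by (rule finite_subset) simp
  then show ?case using insert.IH by (simp add: image_Un)
qed simp

lemma translation_continuous_at_right:
  fixes f :: "real \<Rightarrow> real"
  assumes "x < z" "\<And>y. y \<in> {x..<z} \<Longrightarrow> f y = y + c"
  shows "continuous (at_right x) f"
proof -
  have "((\<lambda>y. y + c) \<longlongrightarrow> x + c) (at_right x)" by (intro tendsto_intros)
  moreover have "eventually (\<lambda>y. f y = y + c) (at_right x)"
    unfolding eventually_at_right[OF assms(1)] using assms by (intro exI[of _ z]) auto
  ultimately have "(f \<longlongrightarrow> x + c) (at_right x)" using tendsto_cong[of f "\<lambda>y. y + c"] by blast
  then show ?thesis using assms by (simp add: continuous_within)
qed

lemma exchange_one: "exchange f \<Longrightarrow> f 1 = 1"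
  by (rule exchange_outside) auto

lemma exchange_bij_betw: "exchange f \<Longrightarrow> bij_betw f {0..1} {0..1}"
proof -
  assume f: "exchange f"
  have "{0..1} = insert 1 {0..<1::real}" by auto
  then have "f ` {0..1} = {0..1}" using exchange_image_unit[OF f] exchange_one[OF f] by simp
  then show ?thesis using exchange_inj_on[OF f] by (simp add: bij_betw_def)
qed

lemma exchange_imp_interval_exchange:
  assumes h: "exchange h"
  shows "interval_exchange (restrict h {0..1})"
  unfolding interval_exchange_def
proof (intro conjI ballI allI impI)
  let ?f = "restrict h {0..1}"
  have pw: "pw_trans h {0..<1}" using h by (simp add: exchange_def)
  have "bij_betw ?f {0..1} {0..1} \<longleftrightarrow> bij_betw h {0..1} {0..1}" by (rule bij_betw_cong) simp
  then show "?f \<in> Bij {0..1}" using exchange_bij_betw[OF h] by (simp only: Bij_def) simp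
  obtain D where D: "finite D"
    "\<And>x. x \<in> {0..<1} - D \<Longrightarrow> \<exists>e>0. \<exists>c. \<forall>y. \<bar>y - x\<bar> < e \<longrightarrow> y \<in> {0..<1} \<and> h y = y + c"
    using pw_trans_local[OF pw] by auto
  have "discontinuities ?f \<subseteq> insert 1 D"
  proof
    fix x assume x: "x \<in> discontinuities ?f"
    show "x \<in> insert 1 D"
    proof (rule ccontr)
      assume "x \<notin> insert 1 D"
      then have "x \<in> {0..<1} - D" using x by (auto simp: discontinuities_def)
      then obtain e c where ec: "e > 0" "\<And>y. \<bar>y - x\<bar> < e \<Longrightarrow> h y = y + c" using D(2) by blast
      have "continuous (at x within {0..1}) ?f"
        by (rule continuous_transform_within[of x "{0..1}" "\<lambda>y. y + c" e])
          (use x ec in \<open>auto simp: discontinuities_def dist_real_def intro!: continuous_intros\<close>)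
      then show False using x by (simp add: discontinuities_def)
    qed
  qed
  then show "finite (discontinuities ?f)" using D(1) finite_subset by blast
  show "continuous (at_right x) ?f" if x: "x \<in> {0..<1}" for x
  proof -
    obtain z c where z: "z > x" "\<And>y. y \<in> {x..<z} \<Longrightarrow> h y = y + c"
      using pw_trans_right_germ[OF pw x] by blast
    show ?thesis
      by (rule translation_continuous_at_right[of x "min z 1" _ c]) (use x z in auto)
  qed
  fix a b assume ab: "0 \<le> a \<and> a < b \<and> b \<le> 1 \<and> {a<..<b} \<inter> discontinuities ?f = {}"
  \<comment> \<open>An interval without discontinuities may still be cut by the pieces of the
    decomposition. A single constant comes from connectedness: the displacement is continuous there
    and takes finitely many values.\<close>
  have "(\<lambda>x. ?f x - x) constant_on {a<..<b}"
  proof (rule continuous_finite_range_constant)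
    show "continuous_on {a<..<b} (\<lambda>x. ?f x - x)"
    proof (intro continuous_on_diff continuous_on_id)
      have "continuous (at x within {a<..<b}) ?f" if "x \<in> {a<..<b}" for x
      proof (rule continuous_within_subset)
        show "continuous (at x within {0..1}) ?f" using ab that by (auto simp: discontinuities_def)
      qed (use ab in auto)
      then show "continuous_on {a<..<b} ?f" unfolding continuous_on_eq_continuous_within by blast
    qed
    have "(\<lambda>x. ?f x - x) ` {a<..<b} \<subseteq> (\<lambda>x. h x - x) ` {0..<1}"
      using ab by (auto intro!: image_eqI)
    then show "finite ((\<lambda>x. ?f x - x) ` {a<..<b})"
      using pw_trans_finite_displacements[OF pw] finite_subset by blast
  qed simp
  then obtain c where "\<And>x. x \<in> {a<..<b} \<Longrightarrow> ?f x - x = c" unfolding constant_on_def by blast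
  then show "\<exists>c. \<forall>x\<in>{a<..<b}. ?f x = x + c" by (intro exI[of _ c]) (auto simp: algebra_simps)
qed

text \<open>Between consecutive points of \<open>D\<close> the definition gives a translation on the
  open interval; right continuity extends the formula to the left end.\<close>

lemma interval_exchange_pw_trans:
  assumes f: "interval_exchange f"
  shows "pw_trans f {0..<1}"
proof -
  define D where "D = insert 0 (insert 1 (discontinuities f))"
  have D: "finite D" "D \<subseteq> {0..1}" "0 \<in> D" "1 \<in> D"
    using f by (auto simp: D_def interval_exchange_def discontinuities_def)
  define nx where "nx d = Min {e \<in> D. d < e}" for d
  have nx: "d < nx d" "nx d \<in> D" "\<And>e. e \<in> D \<Longrightarrow> d < e \<Longrightarrow> nx d \<le> e" if "d \<in> D - {1}" for d
  proof -
    have ne: "finite {e \<in> D. d < e}" "{e \<in> D. d < e} \<noteq> {}" using that D by force+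
    show "d < nx d" "nx d \<in> D" using Min_in[OF ne] by (simp_all add: nx_def)
    show "nx d \<le> e" if "e \<in> D" "d < e" for e using Min_le[OF ne(1)] that by (simp add: nx_def)
  qed
  have "pw_trans f {d..<nx d}" if d: "d \<in> D - {1}" for d
  proof -
    have "{d<..<nx d} \<inter> discontinuities f = {}"
      using nx(3)[OF d] by (fastforce simp: D_def)
    moreover have dn: "0 \<le> d" "d < nx d" "nx d \<le> 1" "d < 1" using nx[OF d] d D by auto
    ultimately obtain c where c: "\<And>x. x \<in> {d<..<nx d} \<Longrightarrow> f x = x + c"
      using f unfolding interval_exchange_def by meson
    have "(f \<longlongrightarrow> f d) (at_right d)"
      using f dn by (simp add: interval_exchange_def continuous_within)
    moreover have "(f \<longlongrightarrow> d + c) (at_right d)"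
    proof -
      have "((\<lambda>y. y + c) \<longlongrightarrow> d + c) (at_right d)" by (intro tendsto_intros)
      moreover have "eventually (\<lambda>y. f y = y + c) (at_right d)"
        unfolding eventually_at_right[OF dn(2)] using c dn by (intro exI[of _ "nx d"]) auto
      ultimately show ?thesis using tendsto_cong[of f "\<lambda>y. y + c"] by blast
    qed
    ultimately have "f d = d + c" using tendsto_unique trivial_limit_at_right_real by blast
    then have "f x = x + c" if "x \<in> {d..<nx d}" for x
      using that c[of x] by (cases "x = d") auto
    then show ?thesis by (rule pw_trans_interval)
  qed
  then have "pw_trans f (\<Union>d\<in>D - {1}. {d..<nx d})" using D by (intro pw_trans_UN) auto
  moreover have "(\<Union>d\<in>D - {1}. {d..<nx d}) = {0..<1}"
  proof (intro equalityI subsetI)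
    fix x assume "x \<in> (\<Union>d\<in>D - {1}. {d..<nx d})"
    then obtain d where "d \<in> D - {1}" "d \<le> x" "x < nx d" by auto
    then show "x \<in> {0..<1}" using nx(2)[of d] D(2) by force
  next
    fix x :: real assume x: "x \<in> {0..<1}"
    define d where "d = Max {e \<in> D. e \<le> x}"
    have ne: "finite {e \<in> D. e \<le> x}" "{e \<in> D. e \<le> x} \<noteq> {}" using x D by auto
    have d: "d \<in> D" "d \<le> x" using Max_in[OF ne] by (simp_all add: d_def)
    then have d1: "d \<in> D - {1}" using x by auto
    have "x < nx d"
    proof (rule ccontr)
      assume "\<not> x < nx d"
      then have "nx d \<le> d" using Max_ge[OF ne(1), of "nx d"] nx(2)[OF d1] by (simp add: d_def)
      then show False using nx(1)[OF d1] by simp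
    qed
    then show "x \<in> (\<Union>d\<in>D - {1}. {d..<nx d})" using d d1 by auto
  qed
  ultimately show ?thesis by simp
qed

lemma interval_exchange_imp_exchange:
  assumes f: "interval_exchange f"
  obtains h where "exchange h" "f = restrict h {0..1}"
proof -
  have bij: "bij_betw f {0..1} {0..1}" and ext: "f \<in> extensional {0..1}"
    using f by (auto simp: interval_exchange_def Bij_def)
  note pw = interval_exchange_pw_trans[OF f]
  have f01: "f y \<in> {0..1}" if "y \<in> {0..1}" for y using bij_betwE[OF bij] that by blast
  \<comment> \<open>A point left of 1 with value 1 would have points just to its right with values
    above 1. So only the point 1 can be mapped to 1.\<close>
  have ne1: "f x \<noteq> 1" if x: "x \<in> {0..<1}" for x
  proof
    assume 1: "f x = 1"
    obtain z c where z: "z > x" "\<And>y. y \<in> {x..<z} \<Longrightarrow> f y = y + c"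
      using pw_trans_right_germ[OF pw x] by blast
    define y where "y = (x + min z 1) / 2"
    have y: "x < y" "y < z" "y < 1" using z(1) x by (auto simp: y_def min_def field_simps)
    then have "f y > 1" using z(2)[of x] z(2)[of y] 1 z(1) by auto
    then show False using f01[of y] y x by auto
  qed
  have "f 1 = 1"
  proof -
    have "1 \<in> f ` {0..1}" using bij by (simp add: bij_betw_def)
    then obtain x where x: "x \<in> {0..1}" "f x = 1" by force
    then have "x = 1" using ne1[of x] by force
    then show ?thesis using x by simp
  qed
  have "{0..1} - {1} = {0..<1::real}" "{0..<1::real} \<subseteq> {0..1}" by auto
  then have "f ` {0..<1} = {0..<1}"
    using inj_on_image_set_diff[of f "{0..1}" "{0..1}" "{1}"] bij \<open>f 1 = 1\<close> by (simp add: bij_betw_def)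
  moreover have "inj_on f {0..<1}" by (rule inj_on_subset[OF bij_betw_imp_inj_on[OF bij]]) auto
  ultimately have "bij_betw f {0..<1} {0..<1}" by (simp add: bij_betw_def)
  from exchange_extend[OF pw this]
  have "exchange (\<lambda>x. if x \<in> {0..<1} then f x else x)" .
  moreover have "f = restrict (\<lambda>x. if x \<in> {0..<1} then f x else x) {0..1}"
  proof
    fix x
    show "f x = restrict (\<lambda>x. if x \<in> {0..<1} then f x else x) {0..1} x"
      using extensional_arb[OF ext, of x] \<open>f 1 = 1\<close> by (cases "x = 1") (auto simp: restrict_def)
  qed
  ultimately show ?thesis by (rule that)
qed

section \<open>Restriction to the unit interval as a homomorphism onto \<open>IET\<close>\<close>

definition to_IET :: "(real \<Rightarrow> real) \<Rightarrow> real \<Rightarrow> real" where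
  "to_IET f = restrict f {0..1}"

lemma carrier_IET: "carrier IET = to_IET ` carrier exchange_group"
  using exchange_imp_interval_exchange interval_exchange_imp_exchange
  by (auto simp: IET_def to_IET_def image_iff) metis

lemma to_IET_Bij: "exchange f \<Longrightarrow> to_IET f \<in> Bij {0..1}"
  using exchange_imp_interval_exchange by (simp add: interval_exchange_def to_IET_def)

lemma group_hom_BijGroup: "group_hom exchange_group (BijGroup {0..1}) to_IET"
proof (intro group_hom.intro group_hom_axioms.intro homI)
  fix f g assume "f \<in> carrier exchange_group" "g \<in> carrier exchange_group"
  then have fg: "exchange f" "exchange g" by auto
  have g01: "g x \<in> {0..1}" if "x \<in> {0..1}" for x using bij_betwE[OF exchange_bij_betw[OF fg(2)]] that by blast
  have "to_IET (f \<circ> g) = compose {0..1} (to_IET f) (to_IET g)"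
    unfolding to_IET_def compose_def using g01 by (intro restrict_ext) simp
  then show "to_IET (f \<otimes>\<^bsub>exchange_group\<^esub> g) = to_IET f \<otimes>\<^bsub>BijGroup {0..1}\<^esub> to_IET g"
    using fg by (simp add: BijGroup_def to_IET_Bij)
next
  show "to_IET f \<in> carrier (BijGroup {0..1})" if "f \<in> carrier exchange_group" for f
    using that to_IET_Bij by (simp add: BijGroup_def)
qed (rule group_exchange_group group_BijGroup)+

text \<open>\<open>IET\<close> is the image of a homomorphism into the group of bijections, so
  closure under composition and inverses is inherited from exchanges of the line.\<close>

lemma group_IET: "group IET"
proof -
  interpret B: group_hom exchange_group "BijGroup {0..1}" to_IET by (rule group_hom_BijGroup)
  have "IET = BijGroup {0..1}\<lparr>carrier := to_IET ` carrier exchange_group\<rparr>"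
    unfolding carrier_IET[symmetric] by (simp add: IET_def)
  then show ?thesis
    using subgroup.subgroup_is_group[OF B.img_is_subgroup group_BijGroup] by simp
qed

lemma group_hom_IET: "group_hom exchange_group IET to_IET"
proof (intro group_hom.intro group_hom_axioms.intro homI)
  interpret B: group_hom exchange_group "BijGroup {0..1}" to_IET by (rule group_hom_BijGroup)
  show "to_IET f \<in> carrier IET" if "f \<in> carrier exchange_group" for f using that by (simp add: carrier_IET)
  show "to_IET (f \<otimes>\<^bsub>exchange_group\<^esub> g) = to_IET f \<otimes>\<^bsub>IET\<^esub> to_IET g"
    if "f \<in> carrier exchange_group" "g \<in> carrier exchange_group" for f g
    using B.hom_mult[OF that] by (simp add: IET_def)
qed (rule group_exchange_group group_IET)+

interpretation IET: group_hom exchange_group IET to_IET by (rule group_hom_IET)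

lemma iet_norm_to_IET: "exchange f \<Longrightarrow> iet_norm (to_IET f) = measure lebesgue (moved f)"
proof -
  assume f: "exchange f"
  then have "iet_support (to_IET f) = moved f"
    using moved_subset[OF f] by (auto simp: iet_support_def to_IET_def moved_def)
  then show ?thesis by (simp add: iet_norm_def)
qed

lemma IET_approximation:
  assumes "\<epsilon> > 0"
  obtains M where "\<And>g h n. g \<in> carrier IET \<Longrightarrow> \<epsilon> \<le> iet_norm g \<Longrightarrow> h \<in> carrier IET \<Longrightarrow>
    \<exists>ps. length ps = M \<and> set ps \<subseteq> carrier IET \<times> carrier IET \<and>
      iet_norm (h \<otimes>\<^bsub>IET\<^esub> inv\<^bsub>IET\<^esub> (comm_conj_prod IET g ps)) \<le> 1 / real (Suc n)"
proof -
  obtain M where M: "\<And>g h n. exchange g \<Longrightarrow> \<epsilon> \<le> measure lebesgue (moved g) \<Longrightarrow> exchange h \<Longrightarrow>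
    \<exists>ps. length ps = M \<and> set ps \<subseteq> carrier exchange_group \<times> carrier exchange_group \<and>
      measure lebesgue (moved (h \<circ> finv (comm_conj_prod exchange_group g ps))) \<le> 1 / real (Suc n)"
    using exchange_approximation[OF assms] by blast
  have "\<exists>ps. length ps = M \<and> set ps \<subseteq> carrier IET \<times> carrier IET \<and>
      iet_norm (h \<otimes>\<^bsub>IET\<^esub> inv\<^bsub>IET\<^esub> (comm_conj_prod IET g ps)) \<le> 1 / real (Suc n)"
    if gh: "g \<in> carrier IET" "\<epsilon> \<le> iet_norm g" "h \<in> carrier IET" for g h n
  proof -
    obtain g' h' where g': "exchange g'" "g = to_IET g'" and h': "exchange h'" "h = to_IET h'"
      using gh by (auto simp: carrier_IET)
    obtain ps where ps: "length ps = M" "set ps \<subseteq> carrier exchange_group \<times> carrier exchange_group"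
      "measure lebesgue (moved (h' \<circ> finv (comm_conj_prod exchange_group g' ps))) \<le> 1 / real (Suc n)"
      using M[OF g'(1) _ h'(1)] gh(2) g' iet_norm_to_IET by metis
    let ?p = "comm_conj_prod exchange_group g' ps"
    have p: "exchange ?p" using EG.comm_conj_prod_closed[of g' ps] ps(2) g'(1) by simp
    have eq: "to_IET ?p = comm_conj_prod IET g (map (map_prod to_IET to_IET) ps)"
      using IET.comm_conj_prod_hom[of g' ps] g' ps(2) by simp
    have "h \<otimes>\<^bsub>IET\<^esub> inv\<^bsub>IET\<^esub> (to_IET ?p) = to_IET (h' \<circ> finv ?p)"
      using IET.hom_mult[of h' "finv ?p"] IET.hom_inv[of ?p] h' p by simp
    then have "iet_norm (h \<otimes>\<^bsub>IET\<^esub> inv\<^bsub>IET\<^esub> (comm_conj_prod IET g (map (map_prod to_IET to_IET) ps)))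
        \<le> 1 / real (Suc n)"
      unfolding eq[symmetric] using ps(3) iet_norm_to_IET h' p by simp
    moreover have "set (map (map_prod to_IET to_IET) ps) \<subseteq> carrier IET \<times> carrier IET"
      using ps(2) by (auto simp: carrier_IET)
    ultimately show ?thesis using ps(1) by (intro exI[of _ "map (map_prod to_IET to_IET) ps"]) simp
  qed
  then show ?thesis by (rule that)
qed

text \<open>Subadditivity and invariance under inversion make the sequences with norm tending to 0 a
  subgroup; invariance under conjugation makes it normal.\<close>

locale normed_group = group G for G (structure) +
  fixes nrm :: "'a \<Rightarrow> real"
  assumes nrm_nonneg: "0 \<le> nrm x"
    and nrm_one: "nrm \<one> = 0"
    and nrm_mult: "x \<in> carrier G \<Longrightarrow> y \<in> carrier G \<Longrightarrow> nrm (x \<otimes> y) \<le> nrm x + nrm y"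
    and nrm_inv: "x \<in> carrier G \<Longrightarrow> nrm (inv x) = nrm x"
    and nrm_conj: "x \<in> carrier G \<Longrightarrow> y \<in> carrier G \<Longrightarrow> nrm (x \<otimes> y \<otimes> inv x) = nrm y"

lemma normed_group_IET: "normed_group IET iet_norm"
proof -
  interpret group IET by (rule group_IET)
  show ?thesis
  proof
    show "0 \<le> iet_norm x" for x by (simp add: iet_norm_def)
    show "iet_norm \<one>\<^bsub>IET\<^esub> = 0"
      using iet_norm_to_IET[of id] IET.hom_one by (simp add: moved_def)
  next
    fix x y assume "x \<in> carrier IET" "y \<in> carrier IET"
    then obtain f g where f: "exchange f" "x = to_IET f" and g: "exchange g" "y = to_IET g"
      by (auto simp: carrier_IET)
    have mult: "x \<otimes>\<^bsub>IET\<^esub> y = to_IET (f \<circ> g)" using IET.hom_mult[of f g] f g by simp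
    have iv: "inv\<^bsub>IET\<^esub> x = to_IET (finv f)" using IET.hom_inv[of f] f by simp
    have "moved (finv f) = moved f"
      unfolding moved_def using f(1) by (metis exchange_inv_f exchange_f_inv)
    then show "iet_norm (inv\<^bsub>IET\<^esub> x) = iet_norm x"
      unfolding iv using f by (simp add: iet_norm_to_IET)
    have "measure lebesgue (moved (f \<circ> g)) \<le> measure lebesgue (moved f \<union> moved g)"
      by (intro lebesgue_mono elementary_moved pw_trans_Un exchange_comp f g) (auto simp: moved_def)
    also have "\<dots> \<le> measure lebesgue (moved f) + measure lebesgue (moved g)"
      by (intro measure_Un_le) (auto simp: fmeasurableD elementary_moved f g)
    finally show "iet_norm (x \<otimes>\<^bsub>IET\<^esub> y) \<le> iet_norm x + iet_norm y"
      unfolding mult using f g by (simp add: iet_norm_to_IET)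
    have "x \<otimes>\<^bsub>IET\<^esub> y \<otimes>\<^bsub>IET\<^esub> inv\<^bsub>IET\<^esub> x = to_IET (f \<circ> g \<circ> finv f)"
      unfolding mult iv using IET.hom_mult[of "f \<circ> g" "finv f"] f g by simp
    then show "iet_norm (x \<otimes>\<^bsub>IET\<^esub> y \<otimes>\<^bsub>IET\<^esub> inv\<^bsub>IET\<^esub> x) = iet_norm y"
      using f g moved_conj[OF f(1), of g] exchange_measure_image[OF f(1) elementary_moved[OF g(1)] moved_subset[OF g(1)]]
      by (simp add: iet_norm_to_IET)
  qed
qed

section \<open>Metric ultrapowers\<close>

text \<open>An ultrafilter containing a singleton is principal, so this one contains all cofinite
  sets. Ordinary limits, such as that of 1/(n+1), are then limits along \<open>U\<close>.\<close>

lemma nonprincipal_le_sequentially: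
  assumes U: "nonprincipal_ultrafilter U"
  shows "U \<le> sequentially"
proof -
  have ne: "eventually (\<lambda>n. n \<noteq> i) U" for i
  proof (rule ccontr)
    assume "\<not> eventually (\<lambda>n. n \<noteq> i) U"
    then have i: "eventually (\<lambda>n. n = i) U"
      using U unfolding nonprincipal_ultrafilter_def by (metis (no_types, lifting) eventually_mono)
    have "U = principal {i}"
    proof (rule filter_eqI)
      fix P
      show "eventually P U \<longleftrightarrow> eventually P (principal {i})"
      proof
        assume "eventually P U"
        then have "eventually (\<lambda>n. P i) U" using i by eventually_elim simp
        moreover have "U \<noteq> bot" using U by (simp add: nonprincipal_ultrafilter_def)
        ultimately have "P i" by (metis eventually_const)
        then show "eventually P (principal {i})" by (simp add: eventually_principal)
      next
        assume "eventually P (principal {i})"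
        then have "P i" by (simp add: eventually_principal)
        then show "eventually P U" using i by (auto elim: eventually_mono)
      qed
    qed
    then show False using U by (simp add: nonprincipal_ultrafilter_def)
  qed
  have "eventually (\<lambda>n. N \<le> n) U" for N
  proof -
    have "eventually (\<lambda>n. \<forall>i\<in>{..<N}. n \<noteq> i) U" by (rule eventually_ball_finite) (auto simp: ne)
    then show ?thesis by (rule eventually_mono) (use not_less in blast)
  qed
  then show ?thesis
    unfolding le_filter_def eventually_sequentially by (metis (no_types, lifting) eventually_mono)
qed

context normed_group
begin

abbreviation seq_group :: "(nat \<Rightarrow> 'a) monoid" where
  "seq_group \<equiv> product_group UNIV (\<lambda>_. G)"

lemma group_seq_group: "group seq_group"
  by (rule product_group) (rule group_axioms)

lemma seq_inv: "x \<in> carrier seq_group \<Longrightarrow> inv\<^bsub>seq_group\<^esub> x = (\<lambda>n. inv (x n))"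
  using inv_product_group[of x UNIV "\<lambda>_. G"] group_axioms by (simp add: restrict_def)

lemma group_hom_eval: "group_hom seq_group G (\<lambda>x. x n)"
  by (intro group_hom.intro group_hom_axioms.intro homI) (auto simp: group_seq_group group_axioms PiE_iff)

lemma null_sequences_normal: "null_sequences G nrm U \<lhd> seq_group"
proof -
  interpret P: group seq_group by (rule group_seq_group)
  note bound = tendsto_sandwich[OF always_eventually[OF allI[OF nrm_nonneg]] _ tendsto_const]
  show ?thesis unfolding P.normal_inv_iff
  proof (intro conjI ballI)
    show "subgroup (null_sequences G nrm U) seq_group"
    proof
      fix x y assume "x \<in> null_sequences G nrm U" "y \<in> null_sequences G nrm U"
      then have xy: "\<And>n. x n \<in> carrier G" "\<And>n. y n \<in> carrier G"
        "((\<lambda>n. nrm (x n)) \<longlongrightarrow> 0) U" "((\<lambda>n. nrm (y n)) \<longlongrightarrow> 0) U"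
        by (auto simp: null_sequences_def PiE_iff)
      have "((\<lambda>n. nrm (x n) + nrm (y n)) \<longlongrightarrow> 0) U" using tendsto_add[OF xy(3,4)] by simp
      then have "((\<lambda>n. nrm (x n \<otimes> y n)) \<longlongrightarrow> 0) U"
        by (intro bound) (auto simp: nrm_mult xy)
      then show "x \<otimes>\<^bsub>seq_group\<^esub> y \<in> null_sequences G nrm U"
        using xy by (simp add: null_sequences_def PiE_iff)
    next
      fix x assume "x \<in> null_sequences G nrm U"
      then have x: "x \<in> carrier seq_group" "\<And>n. x n \<in> carrier G" "((\<lambda>n. nrm (x n)) \<longlongrightarrow> 0) U"
        by (auto simp: null_sequences_def PiE_iff)
      then show "inv\<^bsub>seq_group\<^esub> x \<in> null_sequences G nrm U"
        unfolding seq_inv[OF x(1)] by (simp add: null_sequences_def PiE_iff nrm_inv)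
    qed (auto simp: null_sequences_def PiE_iff nrm_one)
    fix x h assume x: "x \<in> carrier seq_group" and h: "h \<in> null_sequences G nrm U"
    then have "\<And>n. x n \<in> carrier G" "\<And>n. h n \<in> carrier G" by (auto simp: null_sequences_def PiE_iff)
    then show "x \<otimes>\<^bsub>seq_group\<^esub> h \<otimes>\<^bsub>seq_group\<^esub> inv\<^bsub>seq_group\<^esub> x \<in> null_sequences G nrm U"
      using h unfolding seq_inv[OF x] by (simp add: null_sequences_def PiE_iff nrm_conj)
  qed
qed

end

text \<open>The commutator of \<open>g\<close> and \<open>s\<close> is \<open>g\<close> times a
  conjugate of its inverse. This reduces simplicity to the generation of the ultrapower by these
  words.\<close>

lemma comm_conj_prod_normal:
  assumes H: "H \<lhd> G" and g: "g \<in> H" and ps: "set ps \<subseteq> carrier G \<times> carrier G"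
  shows "comm_conj_prod G g ps \<in> H"
proof -
  interpret H: normal H G by (rule H)
  have gG: "g \<in> carrier G" using g by (rule H.mem_carrier)
  have "comm_conj G g (w, s) \<in> H" if "w \<in> carrier G" "s \<in> carrier G" for w s
  proof -
    have "s \<otimes>\<^bsub>G\<^esub> inv\<^bsub>G\<^esub> g \<otimes>\<^bsub>G\<^esub> inv\<^bsub>G\<^esub> s \<in> H" using that g by (simp add: H.inv_op_closed2)
    then have "g \<otimes>\<^bsub>G\<^esub> (s \<otimes>\<^bsub>G\<^esub> inv\<^bsub>G\<^esub> g \<otimes>\<^bsub>G\<^esub> inv\<^bsub>G\<^esub> s) \<in> H" using g by simp
    then have "g \<otimes>\<^bsub>G\<^esub> s \<otimes>\<^bsub>G\<^esub> inv\<^bsub>G\<^esub> g \<otimes>\<^bsub>G\<^esub> inv\<^bsub>G\<^esub> s \<in> H" using that gG by (simp add: H.m_assoc)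
    then show ?thesis using that by (simp add: comm_conj_def H.inv_op_closed2)
  qed
  then show ?thesis using ps by (induction ps) auto
qed

context
  fixes U :: "nat filter"
  assumes U: "nonprincipal_ultrafilter U"
begin

interpretation N: normed_group IET iet_norm by (rule normed_group_IET)

lemma null_normal: "null_sequences IET iet_norm U \<lhd> N.seq_group"
  by (rule N.null_sequences_normal)

lemma group_ultrapower: "group (metric_ultrapower IET iet_norm U)"
  unfolding metric_ultrapower_def by (rule normal.factorgroup_is_group[OF null_normal])

lemma group_hom_ultrapower:
  "group_hom N.seq_group (metric_ultrapower IET iet_norm U)
    (\<lambda>x. null_sequences IET iet_norm U #>\<^bsub>N.seq_group\<^esub> x)"
  using normal.r_coset_hom_Mod[OF null_normal] group_ultrapower N.group_seq_group
  by (simp add: group_hom_def group_hom_axioms_def metric_ultrapower_def)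

text \<open>Both the simplicity and its bounded form follow from this. The number \<open>M\<close>
  is that of the approximation in \<open>IET\<close> for a lower bound \<epsilon> on the norms of a
  representative of \<open>c\<close>.\<close>

lemma ultrapower_bounded_generation:
  assumes c: "c \<in> carrier (metric_ultrapower IET iet_norm U)" "c \<noteq> \<one>\<^bsub>metric_ultrapower IET iet_norm U\<^esub>"
  obtains M where "\<And>x. x \<in> carrier (metric_ultrapower IET iet_norm U) \<Longrightarrow>
    \<exists>ps. length ps = M \<and>
      set ps \<subseteq> carrier (metric_ultrapower IET iet_norm U) \<times> carrier (metric_ultrapower IET iet_norm U) \<and>
      x = comm_conj_prod (metric_ultrapower IET iet_norm U) c ps"
proof -
  let ?P = "N.seq_group" and ?K = "null_sequences IET iet_norm U"
  let ?Q = "metric_ultrapower IET iet_norm U"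
  define q where "q x = ?K #>\<^bsub>?P\<^esub> x" for x
  interpret K: normal ?K ?P by (rule null_normal)
  interpret q: group_hom ?P ?Q q unfolding q_def[abs_def] by (rule group_hom_ultrapower)
  have surj: "\<exists>y\<in>carrier ?P. x = q y" if "x \<in> carrier ?Q" for x
    using that by (auto simp: metric_ultrapower_def FactGroup_def RCOSETS_def q_def)
  have qK: "q x = \<one>\<^bsub>?Q\<^esub>" if "x \<in> ?K" for x
    using K.coset_join2[OF K.mem_carrier[OF that] K.subgroup_axioms that]
    by (simp add: q_def metric_ultrapower_def FactGroup_def)
  obtain g where g: "g \<in> carrier ?P" "c = q g" using surj[OF c(1)] by blast
  have "g \<notin> ?K" using qK c(2) g(2) by blast
  then have "\<not> ((\<lambda>n. iet_norm (g n)) \<longlongrightarrow> 0) U" using g(1) by (simp add: null_sequences_def)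
  then obtain \<epsilon> where e: "\<epsilon> > 0" "\<not> eventually (\<lambda>n. iet_norm (g n) < \<epsilon>) U"
    using N.nrm_nonneg by (auto simp: tendsto_iff)
  \<comment> \<open>Here the ultrafilter property is used: failing to be eventually below \<epsilon>
    means being eventually at least \<epsilon>.\<close>
  then have ev: "eventually (\<lambda>n. \<epsilon> \<le> iet_norm (g n)) U"
    using U unfolding nonprincipal_ultrafilter_def
    by (metis (mono_tags, lifting) eventually_mono not_less)
  obtain M where M: "\<And>g h n. g \<in> carrier IET \<Longrightarrow> \<epsilon> \<le> iet_norm g \<Longrightarrow> h \<in> carrier IET \<Longrightarrow>
    \<exists>ps. length ps = M \<and> set ps \<subseteq> carrier IET \<times> carrier IET \<and>
      iet_norm (h \<otimes>\<^bsub>IET\<^esub> inv\<^bsub>IET\<^esub> (comm_conj_prod IET g ps)) \<le> 1 / real (Suc n)"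
    using IET_approximation[OF e(1)] by blast
  have "\<exists>ps. length ps = M \<and> set ps \<subseteq> carrier ?Q \<times> carrier ?Q \<and> x = comm_conj_prod ?Q c ps"
    if x: "x \<in> carrier ?Q" for x
  proof -
    obtain h where h: "h \<in> carrier ?P" "x = q h" using surj[OF x] by blast
    have gh: "g n \<in> carrier IET" "h n \<in> carrier IET" for n using g(1) h(1) by (simp_all add: PiE_iff)
    have "\<exists>ps. length ps = M \<and> set ps \<subseteq> carrier IET \<times> carrier IET \<and> (\<epsilon> \<le> iet_norm (g n) \<longrightarrow>
      iet_norm (h n \<otimes>\<^bsub>IET\<^esub> inv\<^bsub>IET\<^esub> (comm_conj_prod IET (g n) ps)) \<le> 1 / real (Suc n))" for n
    proof (cases "\<epsilon> \<le> iet_norm (g n)")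
      case True
      then show ?thesis using M[OF gh(1) _ gh(2), of n n n] by blast
    next
      case False
      \<comment> \<open>At the exceptional coordinates any list of the right length will do, as they
        form a set outside the ultrafilter.\<close>
      then show ?thesis by (intro exI[of _ "replicate M (\<one>\<^bsub>IET\<^esub>, \<one>\<^bsub>IET\<^esub>)"]) (auto simp: set_replicate_conv_if)
    qed
    then obtain ps where ps: "\<And>n. length (ps n) = M" "\<And>n. set (ps n) \<subseteq> carrier IET \<times> carrier IET"
      "\<And>n. \<epsilon> \<le> iet_norm (g n) \<Longrightarrow>
        iet_norm (h n \<otimes>\<^bsub>IET\<^esub> inv\<^bsub>IET\<^esub> (comm_conj_prod IET (g n) (ps n))) \<le> 1 / real (Suc n)"
      by metis
    \<comment> \<open>Transposition: a sequence of lists of common length \<open>M\<close> becomes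
      one list of \<open>M\<close> pairs of sequences.\<close>
    define ws where "ws = map (\<lambda>i. (\<lambda>n. fst (ps n ! i), \<lambda>n. snd (ps n ! i))) [0..<M]"
    have mem: "fst (ps n ! i) \<in> carrier IET" "snd (ps n ! i) \<in> carrier IET" if "i < M" for n i
    proof -
      have "ps n ! i \<in> carrier IET \<times> carrier IET" 
        using ps(2)[of n] nth_mem[of i "ps n"] that by (auto simp only: ps(1))
      then show "fst (ps n ! i) \<in> carrier IET" "snd (ps n ! i) \<in> carrier IET" by (auto simp: mem_Times_iff)
    qed
    have ws: "set ws \<subseteq> carrier ?P \<times> carrier ?P" using mem by (auto simp: ws_def PiE_iff)
    define p where "p = comm_conj_prod ?P g ws"
    have pP: "p \<in> carrier ?P" unfolding p_def by (rule K.comm_conj_prod_closed[OF g(1) ws])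
    have pn: "p n = comm_conj_prod IET (g n) (ps n)" for n
    proof -
      have "map (map_prod (\<lambda>y. y n) (\<lambda>y. y n)) ws = ps n"
        by (rule nth_equalityI) (simp_all add: ws_def ps(1))
      then show ?thesis
        using group_hom.comm_conj_prod_hom[OF N.group_hom_eval g(1) ws, of n] by (simp add: p_def)
    qed
    let ?d = "h \<otimes>\<^bsub>?P\<^esub> inv\<^bsub>?P\<^esub> p"
    have dn: "?d n = h n \<otimes>\<^bsub>IET\<^esub> inv\<^bsub>IET\<^esub> (comm_conj_prod IET (g n) (ps n))" for n
      unfolding N.seq_inv[OF pP] by (simp add: pn)
    have lim: "((\<lambda>n. 1 / real (Suc n)) \<longlongrightarrow> 0) U"
      by (rule tendsto_mono[OF nonprincipal_le_sequentially[OF U] LIMSEQ_Suc[OF lim_1_over_n]])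
    have "((\<lambda>n. iet_norm (?d n)) \<longlongrightarrow> 0) U"
    proof (rule tendsto_sandwich[OF _ _ tendsto_const lim])
      show "eventually (\<lambda>n. 0 \<le> iet_norm (?d n)) U" by (simp add: N.nrm_nonneg)
      show "eventually (\<lambda>n. iet_norm (?d n) \<le> 1 / real (Suc n)) U"
        using ev by (rule eventually_mono) (simp only: dn ps(3))
    qed
    moreover have dP: "?d \<in> carrier ?P" using h(1) pP by (intro K.m_closed K.inv_closed)
    ultimately have "?d \<in> ?K" by (simp only: null_sequences_def mem_Collect_eq)
    \<comment> \<open>The quotient map sends the null sequence \<open>?d\<close> to the identity, so
      \<open>h\<close> and the word \<open>p\<close> represent the same class.\<close>
    have "h = ?d \<otimes>\<^bsub>?P\<^esub> p"
      using K.m_assoc[OF h(1) K.inv_closed[OF pP] pP] K.l_inv[OF pP] K.r_one[OF h(1)] by metis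
    then have "q h = q ?d \<otimes>\<^bsub>?Q\<^esub> q p" using q.hom_mult[OF dP pP] by metis
    then have "x = q p" using qK[OF \<open>?d \<in> ?K\<close>] q.hom_closed[OF pP] h(2) by (metis q.H.l_one)
    also have "q p = comm_conj_prod ?Q c (map (map_prod q q) ws)"
      unfolding p_def g(2) by (rule q.comm_conj_prod_hom[OF g(1) ws])
    finally have "x = comm_conj_prod ?Q c (map (map_prod q q) ws)" .
    moreover have "set (map (map_prod q q) ws) \<subseteq> carrier ?Q \<times> carrier ?Q"
      using ws q.hom_closed by fastforce
    ultimately show ?thesis by (intro exI[of _ "map (map_prod q q) ws"]) (simp add: ws_def)
  qed
  then show ?thesis using that by blast
qed

text \<open>The constant sequence of an involution moving all of \<open>{0..<1}\<close> has norm 1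
  at every coordinate, so it is not null.\<close>

lemma ultrapower_nontrivial:
  "carrier (metric_ultrapower IET iet_norm U) \<noteq> {\<one>\<^bsub>metric_ultrapower IET iet_norm U\<^esub>}"
proof
  let ?P = "N.seq_group" and ?K = "null_sequences IET iet_norm U"
  let ?Q = "metric_ultrapower IET iet_norm U"
  assume triv: "carrier ?Q = {\<one>\<^bsub>?Q\<^esub>}"
  interpret K: normal ?K ?P by (rule null_normal)
  obtain s where s: "exchange s" "measure lebesgue (moved s) = 1"
    using involution_exists[of "{0..<1}" 1] by (auto simp: measure_interval)
  define x where "x = (\<lambda>n::nat. to_IET s)"
  have x: "x \<in> carrier ?P" using s(1) by (simp add: x_def PiE_iff carrier_IET)
  then have "?K #>\<^bsub>?P\<^esub> x \<in> carrier ?Q"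
    by (auto simp: metric_ultrapower_def FactGroup_def RCOSETS_def)
  then have "?K #>\<^bsub>?P\<^esub> x = ?K" using triv by (simp add: metric_ultrapower_def FactGroup_def)
  then have "x \<in> ?K" using x by (rule K.coset_join1[OF _ _ K.subgroup_axioms])
  then have "((\<lambda>n::nat. 1 :: real) \<longlongrightarrow> 0) U"
    using s by (simp add: null_sequences_def x_def iet_norm_to_IET)
  moreover have "U \<noteq> bot" using U by (simp add: nonprincipal_ultrafilter_def)
  ultimately show False using tendsto_const_iff[of U "1::real" 0] by simp
qed

end

theorem theorem7p1:
  fixes U :: "nat filter"
  assumes "nonprincipal_ultrafilter U"
  shows "is_simple (metric_ultrapower IET iet_norm U) \<and>
         boundedly_simple (metric_ultrapower IET iet_norm U)"
proof
  let ?Q = "metric_ultrapower IET iet_norm U"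
  interpret Q: group ?Q by (rule group_ultrapower[OF assms])
  note gen = ultrapower_bounded_generation[OF assms]
  show "is_simple ?Q" unfolding is_simple_def
  proof (intro conjI allI impI ultrapower_nontrivial[OF assms] Q.group_axioms)
    fix H assume H: "H \<lhd> ?Q"
    interpret H: normal H ?Q by (rule H)
    show "H = carrier ?Q \<or> H = {\<one>\<^bsub>?Q\<^esub>}"
    proof (rule disjCI)
      assume "H \<noteq> {\<one>\<^bsub>?Q\<^esub>}"
      then obtain c where c: "c \<in> H" "c \<noteq> \<one>\<^bsub>?Q\<^esub>" using H.one_closed by blast
      have "x \<in> H" if x: "x \<in> carrier ?Q" for x
      proof -
        obtain ps where "set ps \<subseteq> carrier ?Q \<times> carrier ?Q" "x = comm_conj_prod ?Q c ps"
          using gen[OF H.mem_carrier[OF c(1)] c(2)] x by metis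
        then show ?thesis using comm_conj_prod_normal[OF H c(1)] by simp
      qed
      then show "H = carrier ?Q" using H.subset by blast
    qed
  qed
  show "boundedly_simple ?Q" unfolding boundedly_simple_def
  proof (intro conjI ballI Q.group_axioms)
    fix c assume c: "c \<in> carrier ?Q - {\<one>\<^bsub>?Q\<^esub>}"
    then obtain M where M: "\<And>x. x \<in> carrier ?Q \<Longrightarrow>
      \<exists>ps. length ps = M \<and> set ps \<subseteq> carrier ?Q \<times> carrier ?Q \<and> x = comm_conj_prod ?Q c ps"
      using gen[of c] by blast
    show "\<exists>N. \<forall>x\<in>carrier ?Q. \<exists>cs. length cs \<le> N \<and> set cs \<subseteq> conjugates_pm ?Q c \<and>
      x = foldr (\<otimes>\<^bsub>?Q\<^esub>) cs \<one>\<^bsub>?Q\<^esub>"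
    \<comment> \<open>Each factor \<open>w [c, s] w\<inverse>\<close> contributes one conjugate of
      \<open>c\<close> and one of its inverse.\<close>
    proof (intro exI[of _ "2 * M"] ballI)
      fix x assume "x \<in> carrier ?Q"
      then obtain ps where ps: "length ps = M" "set ps \<subseteq> carrier ?Q \<times> carrier ?Q"
        "x = comm_conj_prod ?Q c ps" using M by blast
      then show "\<exists>cs. length cs \<le> 2 * M \<and> set cs \<subseteq> conjugates_pm ?Q c \<and>
        x = foldr (\<otimes>\<^bsub>?Q\<^esub>) cs \<one>\<^bsub>?Q\<^esub>"
        using Q.comm_conj_prod_conjugates[OF DiffD1[OF c] ps(2)] by (metis order_refl)
    qed
  qed
qed

end
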